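(* Let $G$ be a virtually abelian group and $H$ a finitely generated group (with any fixed finite choice of generators). Then $H$ has word problem accepted by a $G$-automaton if and only if $H$ has a finite index subgroup which embeds in $G$.
   Context: $X^*$ denotes the free monoid on $X$. A (finite) choice of generators for a group $H$ is a surjective monoid morphism $\sigma : X^* \to H$ with $X$ a finite alphabet; the word problem for $H$ with respect to $\sigma$ is the language $\{ w \in X^* \mid w\sigma = 1 \}$. For a monoid (in particular a group) $M$ with identity $1$ and a finite alphabet $X$, an $M$-automaton over $X$ is a (non-deterministic) finite automaton over the direct product monoid $M \times X^*$, that is, a finite directed graph whose edges are labelled by elements of $M \times X^*$, with a designated initial state and a set of terminal states; the label of a path is the product of its edge labels. It accepts $w \in X^*$ if there is a path from the initial state to a terminal state labelled $(1,w)$; the language accepted is the set of all accepted words. A group is virtually abelian if it has an abelian subgroup of finite index. *)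

theory Defs
  imports "HOL-Algebra.Coset"
begin

definition free_monoid :: "'x set \<Rightarrow> 'x list monoid" where
  "free_monoid X = \<lparr>carrier = lists X, mult = (@), one = []\<rparr>"

lemma monoid_free_monoid: "monoid (free_monoid X)"
  by unfold_locales (auto simp: free_monoid_def)

text \<open>
  A member of \<open>hom\<close> is only required to preserve multiplication, but a surjective such map
  between monoids automatically preserves the identity.
\<close>

definition choice_of_generators ::
    "('h, 'd) monoid_scheme \<Rightarrow> 'x set \<Rightarrow> ('x list \<Rightarrow> 'h) \<Rightarrow> bool" where
  "choice_of_generators H X \<sigma> \<longleftrightarrow> finite X \<and> \<sigma> \<in> epi (free_monoid X) H"

definition word_problem ::
    "('h, 'd) monoid_scheme \<Rightarrow> 'x set \<Rightarrow> ('x list \<Rightarrow> 'h) \<Rightarrow> 'x list set" where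
  "word_problem H X \<sigma> = {w \<in> lists X. \<sigma> w = \<one>\<^bsub>H\<^esub>}"

record ('q, 'm) automaton =
  states :: "'q set"
  edges :: "('q \<times> 'm \<times> 'q) set"
  initial :: 'q
  terminals :: "'q set"

definition finite_automaton_over ::
    "('m, 'c) monoid_scheme \<Rightarrow> ('q, 'm) automaton \<Rightarrow> bool" where
  "finite_automaton_over M A \<longleftrightarrow>
     finite (states A) \<and> finite (edges A) \<and>
     edges A \<subseteq> states A \<times> carrier M \<times> states A \<and>
     initial A \<in> states A \<and> terminals A \<subseteq> states A"

inductive path_label ::
    "('m, 'c) monoid_scheme \<Rightarrow> ('q, 'm) automaton \<Rightarrow> 'q \<Rightarrow> 'm \<Rightarrow> 'q \<Rightarrow> bool"
  for M A where
  empty_path: "p \<in> states A \<Longrightarrow> path_label M A p \<one>\<^bsub>M\<^esub> p"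
| edge_path: "(p, m, q) \<in> edges A \<Longrightarrow> path_label M A q n r \<Longrightarrow>
    path_label M A p (m \<otimes>\<^bsub>M\<^esub> n) r"

definition M_automaton ::
    "('m, 'c) monoid_scheme \<Rightarrow> 'x set \<Rightarrow> ('q, 'm \<times> 'x list) automaton \<Rightarrow> bool" where
  "M_automaton M X A \<longleftrightarrow> finite X \<and> finite_automaton_over (M \<times>\<times> free_monoid X) A"

definition accepted_language ::
    "('m, 'c) monoid_scheme \<Rightarrow> 'x set \<Rightarrow> ('q, 'm \<times> 'x list) automaton \<Rightarrow> 'x list set" where
  "accepted_language M X A =
     {w \<in> lists X. \<exists>t \<in> terminals A.
        path_label (M \<times>\<times> free_monoid X) A (initial A) (\<one>\<^bsub>M\<^esub>, w) t}"

text \<open>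
  The state set is finite, so taking its elements to be natural numbers loses no generality.
\<close>

definition accepted_by_M_automaton ::
    "('m, 'c) monoid_scheme \<Rightarrow> 'x set \<Rightarrow> 'x list set \<Rightarrow> bool" where
  "accepted_by_M_automaton M X L \<longleftrightarrow>
     (\<exists>A :: (nat, 'm \<times> 'x list) automaton. M_automaton M X A \<and> accepted_language M X A = L)"

definition finite_index_subgroup :: "'a set \<Rightarrow> ('a, 'b) monoid_scheme \<Rightarrow> bool" where
  "finite_index_subgroup K G \<longleftrightarrow> subgroup K G \<and> finite (rcosets\<^bsub>G\<^esub> K)"

definition virtually_abelian :: "('a, 'b) monoid_scheme \<Rightarrow> bool" where
  "virtually_abelian G \<longleftrightarrow>
     (\<exists>K. finite_index_subgroup K G \<and> comm_group (G\<lparr>carrier := K\<rparr>))"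

end

theory Submission
  imports Defs "HOL-Algebra.Generated_Groups" "HOL-Algebra.Divisibility" "HOL.Topological_Spaces"
begin

text \<open>
  An embedding \<open>\<phi>\<close> of a finite index subgroup \<open>L\<close> of \<open>H\<close> into \<open>G\<close> gives a \<open>G\<close>-automaton for the word
  problem: its states are coset representatives \<open>s\<close> of \<open>L\<close>, and reading a letter \<open>x\<close> replaces \<open>s\<close> by
  the representative \<open>s'\<close> of \<open>s \<cdot> \<sigma> x\<close> while multiplying the register by \<open>\<phi> (s \<cdot> \<sigma> x \<cdot> s'\<inverse>)\<close>
  (\<open>accepted_if_embedding\<close>).

  For the converse, the same coset bookkeeping, now inside \<open>G\<close>, moves the part of the register that
  lies outside an abelian finite index subgroup \<open>K\<close> into the states, so the register may be taken to
  lie in the abelian group \<open>K\<close> (\<open>embedding_if_accepted\<close>). Commutativity means that the register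
  value of a walk depends only on how often each edge is used. Let \<open>S\<close> be the set of edges of an
  accepting walk, and call a closed walk at \<open>q\<close> inside \<open>S\<close> available if some balanced multiset of
  edges of \<open>S\<close> cancels its register value. Such a balanced multiset can be woven into the
  accepting walk, after which the closed walk itself can be inserted at \<open>q\<close>; the result accepts. Hence
  two available closed walks with the same register value can be exchanged in an accepting walk, and so
  read words with the same value in \<open>H\<close> (\<open>loop_label_determined\<close>). The pairs (register value,
  value in \<open>H\<close>) therefore form a submonoid of \<open>K \<times> H\<close> which is the graph of a function, and its group of
  fractions is the graph of a homomorphism from a subgroup of \<open>K\<close> to \<open>H\<close>.

  There are finitely many pairs \<open>(S, q)\<close>, and after conjugation by the finitely many words by which a
  walk can overrun a prefix, the images of these homomorphisms are so large that finitely many of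
  their cosets cover \<open>H\<close>. Otherwise there would be an infinite chain of words \<open>u 0, u 1, \<dots>\<close>, each a
  prefix of the next, such that no quotient of the values of two of them lies in any of the images. Take an
  accepting walk for a word that starts with \<open>u n\<close> and represents \<open>1\<close>. By Dickson's lemma some
  earlier accepting walk has the same edge set, the same end and at most the same edge
  multiplicities, where \<open>n\<close> may be taken as large as the length of the earlier walk requires. Reserve
  positions of the long walk that account for the earlier one. As the prefixes far outnumber the
  reserved positions, two of them end at the same state with the same overrun and with no reserved
  position in between; the segment between them is then an available closed walk
  (\<open>loop_between_prefixes\<close>), a contradiction.

  By B. H. Neumann's theorem on coverings by cosets, one of the images has finite index in \<open>H\<close>. It is
  finitely generated by Schreier's lemma, and leaving out dependent generators one at a time makes the
  homomorphism injective without losing finite index (\<open>injective_finite_index_lift\<close>). Its inverse is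
  the required embedding.
\<close>

section \<open>Coverings by cosets of subgroups\<close>

lemma (in group) finite_rcosets_of_cover:
  assumes B: "subgroup B G" and F: "finite F" "F \<subseteq> carrier G"
    and cov: "carrier G \<subseteq> B <#> F"
  shows "finite (rcosets B)"
proof (rule finite_subset)
  show "rcosets B \<subseteq> (\<lambda>f. B #> f) ` F"
  proof
    fix C assume "C \<in> rcosets B"
    then obtain x where x: "x \<in> carrier G" "C = B #> x" by (auto simp: RCOSETS_def)
    then obtain b f where bf: "b \<in> B" "f \<in> F" "x = b \<otimes> f"
      using cov by (auto simp: set_mult_def)
    then have "x \<in> B #> f" by (auto simp: r_coset_def)
    then have "B #> f = B #> x"
      using repr_independence[of x B f] B F bf(2) by auto
    then show "C \<in> (\<lambda>f. B #> f) ` F" using x bf by auto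
  qed
qed (use F in simp)

lemma (in group) cover_of_finite_rcosets:
  assumes B: "subgroup B G" and fin: "finite (rcosets B)"
  obtains F where "finite F" "F \<subseteq> carrier G" "carrier G \<subseteq> B <#> F"
proof -
  have "\<forall>C \<in> rcosets B. \<exists>x. x \<in> carrier G \<and> C = B #> x" by (auto simp: RCOSETS_def)
  then obtain r where r: "\<And>C. C \<in> rcosets B \<Longrightarrow> r C \<in> carrier G \<and> C = B #> r C" by metis
  have "carrier G \<subseteq> B <#> r ` (rcosets B)"
  proof
    fix x assume x: "x \<in> carrier G"
    then have C: "B #> x \<in> rcosets B" by (auto simp: RCOSETS_def)
    have "x \<in> B #> x" using x B by (simp add: rcos_self)
    then have "x \<in> B #> r (B #> x)" using r[OF C] by simp
    then show "x \<in> B <#> r ` (rcosets B)" using C by (auto simp: r_coset_def set_mult_def)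
  qed
  then show thesis using that[of "r ` (rcosets B)"] fin r by blast
qed

text \<open>
  B. H. Neumann's theorem: a group covered by finitely many cosets of finitely many subgroups
  has one of these subgroups with finite index. If the cosets of one of the subgroups do not suffice on
  their own, then one of its cosets, hence each of them, is covered by the others, and this subgroup can
  be discarded.
\<close>
lemma (in group) neumann_cosets:
  assumes "finite I"
    and "\<And>i. i \<in> I \<Longrightarrow> subgroup (A i) G"
    and "\<And>i. i \<in> I \<Longrightarrow> finite (F i)" "\<And>i. i \<in> I \<Longrightarrow> F i \<subseteq> carrier G"
    and "carrier G \<subseteq> (\<Union>i\<in>I. A i <#> F i)"
  shows "\<exists>i\<in>I. finite (rcosets (A i))"
  using assms
proof (induction I arbitrary: F rule: finite_induct)
  case empty
  then show ?case by auto
next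
  case (insert i I)
  have Ai: "subgroup (A i) G" and Fi: "finite (F i)" "F i \<subseteq> carrier G"
    using insert.prems by auto
  show ?case
  proof (cases "carrier G \<subseteq> A i <#> F i")
    case True
    then show ?thesis using finite_rcosets_of_cover[OF Ai Fi] by auto
  next
    case False
    then obtain y where y: "y \<in> carrier G" "y \<notin> A i <#> F i" by auto
    \<comment> \<open>The coset of \<open>y\<close> avoids the cosets of \<open>A i\<close> in the cover, so the other subgroups cover it;
      translating by \<open>inv y \<otimes> f\<close> lets them cover every other coset of \<open>A i\<close> as well.\<close>
    define F' where "F' j = F j \<union> (\<lambda>(k, f). k \<otimes> (inv y \<otimes> f)) ` (F j \<times> F i)" for j
    have yc: "\<exists>j\<in>I. a \<otimes> y \<in> A j <#> F j" if a: "a \<in> A i" for a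
    proof -
      have ac: "a \<in> carrier G" using a Ai subgroup.mem_carrier by metis
      have "a \<otimes> y \<notin> A i <#> F i"
      proof
        assume "a \<otimes> y \<in> A i <#> F i"
        then obtain b f where b: "b \<in> A i" "f \<in> F i" "a \<otimes> y = b \<otimes> f"
          by (auto simp: set_mult_def)
        have bc: "b \<in> carrier G" "f \<in> carrier G" using b Ai Fi subgroup.mem_carrier by auto
        have "y = inv a \<otimes> (a \<otimes> y)" using ac y by (simp add: m_assoc[symmetric])
        also have "\<dots> = (inv a \<otimes> b) \<otimes> f" using b ac bc by (simp add: m_assoc)
        finally have "y = (inv a \<otimes> b) \<otimes> f" .
        moreover have "inv a \<otimes> b \<in> A i"
          using a b Ai by (simp add: subgroup.m_closed subgroup.m_inv_closed)
        ultimately show False using y b by (auto simp: set_mult_def)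
      qed
      moreover have "a \<otimes> y \<in> carrier G" using ac y by simp
      ultimately show ?thesis using insert.prems(4) by auto
    qed
    have sub: "A j <#> F j \<subseteq> A j <#> F' j" for j by (auto simp: F'_def set_mult_def)
    have "\<exists>i\<in>I. finite (rcosets (A i))"
    proof (rule insert.IH)
      show "subgroup (A j) G" if "j \<in> I" for j using insert.prems that by auto
      show "finite (F' j)" if "j \<in> I" for j
        using insert.prems(2) that Fi by (auto simp: F'_def)
      show "F' j \<subseteq> carrier G" if "j \<in> I" for j
        using insert.prems(3)[of j] that Fi y by (auto simp: F'_def)
      show "carrier G \<subseteq> (\<Union>j\<in>I. A j <#> F' j)"
      proof
        fix x assume x: "x \<in> carrier G"
        then obtain j where j: "j \<in> insert i I" "x \<in> A j <#> F j" using insert.prems(4) by auto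
        show "x \<in> (\<Union>j\<in>I. A j <#> F' j)"
        proof (cases "j = i")
          case False
          then show ?thesis using j sub by auto
        next
          case True
          then obtain a f where a: "a \<in> A i" "f \<in> F i" "x = a \<otimes> f"
            using j by (auto simp: set_mult_def)
          then obtain l where l: "l \<in> I" "a \<otimes> y \<in> A l <#> F l" using yc by blast
          then obtain b k where b: "b \<in> A l" "k \<in> F l" "a \<otimes> y = b \<otimes> k"
            by (auto simp: set_mult_def)
          have c: "a \<in> carrier G" "f \<in> carrier G" "b \<in> carrier G" "k \<in> carrier G"
            using a b Ai Fi insert.prems(1)[of l] insert.prems(3)[of l] l subgroup.mem_carrier
            by auto
          have "y \<otimes> (inv y \<otimes> f) = f" using c y by (simp add: m_assoc[symmetric])
          then have "x = (a \<otimes> y) \<otimes> (inv y \<otimes> f)" using a c y by (simp add: m_assoc)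
          also have "\<dots> = b \<otimes> (k \<otimes> (inv y \<otimes> f))" using b c y by (simp add: m_assoc)
          finally have "x \<in> A l <#> F' l" using a b by (auto simp: set_mult_def F'_def)
          then show ?thesis using l by auto
        qed
      qed
    qed
    then show ?thesis by auto
  qed
qed

section \<open>Coset representatives and cofactors\<close>

text \<open>
  The function \<open>rep\<close> chooses a representative of each right coset of \<open>B\<close>, with \<open>\<one>\<close> representing \<open>B\<close>.
  Every \<open>x\<close> then factors as \<open>cofactor x \<otimes> rep x\<close> with the first factor in \<open>B\<close>, so that right
  multiplication on the group becomes a finite state machine on representatives with output in \<open>B\<close>.
\<close>
locale coset_section = group G for G (structure) +
  fixes B and rep
  assumes subgroup_B: "subgroup B G"
    and rep_closed [simp]: "x \<in> carrier G \<Longrightarrow> rep x \<in> carrier G"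
    and cofactor_closed: "x \<in> carrier G \<Longrightarrow> x \<otimes> inv (rep x) \<in> B"
    and rep_mult: "b \<in> B \<Longrightarrow> x \<in> carrier G \<Longrightarrow> rep (b \<otimes> x) = rep x"
    and rep_one [simp]: "rep \<one> = \<one>"
    and finite_reps: "finite (rep ` carrier G)"
begin

definition cofactor where "cofactor x = x \<otimes> inv (rep x)"

lemma B_carrier: "b \<in> B \<Longrightarrow> b \<in> carrier G"
  using subgroup_B subgroup.mem_carrier by metis

lemma cofactor_in_B: "x \<in> carrier G \<Longrightarrow> cofactor x \<in> B"
  by (simp add: cofactor_def cofactor_closed)

lemma cofactor_carrier [simp]: "x \<in> carrier G \<Longrightarrow> cofactor x \<in> carrier G"
  by (simp add: cofactor_in_B B_carrier)

lemma cofactor_rep: "x \<in> carrier G \<Longrightarrow> cofactor x \<otimes> rep x = x"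
  by (simp add: cofactor_def m_assoc)

lemma rep_B: "b \<in> B \<Longrightarrow> rep b = \<one>"
  using rep_mult[of b \<one>] B_carrier by simp

lemma cofactor_B: "b \<in> B \<Longrightarrow> cofactor b = b"
  by (simp add: cofactor_def rep_B B_carrier)

lemma rep_rep_mult: "x \<in> carrier G \<Longrightarrow> y \<in> carrier G \<Longrightarrow> rep (rep x \<otimes> y) = rep (x \<otimes> y)"
  using rep_mult[of "cofactor x" "rep x \<otimes> y"] cofactor_rep[of x] cofactor_in_B[of x]
  by (simp add: m_assoc[symmetric])

lemma rep_rep [simp]: "x \<in> carrier G \<Longrightarrow> rep (rep x) = rep x"
  using rep_rep_mult[of x \<one>] by simp

lemma cofactor_one_rep [simp]: "x \<in> carrier G \<Longrightarrow> cofactor (rep x) = \<one>"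
  by (simp add: cofactor_def)

text \<open>
  The cocycle identity: the outputs of the machine along a product multiply up to the output of
  the product.
\<close>
lemma cofactor_mult:
  assumes "x \<in> carrier G" "y \<in> carrier G"
  shows "cofactor (x \<otimes> y) = cofactor x \<otimes> cofactor (rep x \<otimes> y)"
proof -
  have "cofactor x \<otimes> cofactor (rep x \<otimes> y) = (cofactor x \<otimes> rep x) \<otimes> y \<otimes> inv (rep (x \<otimes> y))"
    unfolding cofactor_def[of "rep x \<otimes> y"] rep_rep_mult[OF assms] using assms
    by (simp add: m_assoc)
  then show ?thesis using assms by (simp add: cofactor_rep cofactor_def[of "x \<otimes> y"])
qed

text \<open>
  Schreier's lemma: the outputs produced by single generators generate \<open>B\<close>, because an element of \<open>B\<close>
  is its own cofactor, which the cocycle identity splits along a word in the generators.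
\<close>
lemma schreier:
  assumes Y: "finite Y" "Y \<subseteq> carrier G"
    and gen: "\<And>g. g \<in> carrier G \<Longrightarrow> \<exists>ys. set ys \<subseteq> Y \<and> g = foldr (\<otimes>) ys \<one>"
  obtains C where "finite C" "C \<subseteq> B" "B \<subseteq> generate G C"
proof -
  define C where "C = (\<lambda>(s, y). cofactor (s \<otimes> y)) ` (rep ` carrier G \<times> Y)"
  have CB: "C \<subseteq> B" using Y cofactor_in_B by (auto simp: C_def)
  have fold: "foldr (\<otimes>) ys \<one> \<in> carrier G" if "set ys \<subseteq> Y" for ys
    using that Y by (induction ys) auto
  have key: "cofactor (rep x \<otimes> foldr (\<otimes>) ys \<one>) \<in> generate G C"
    if "x \<in> carrier G" "set ys \<subseteq> Y" for x ys
    using that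
  proof (induction ys arbitrary: x)
    case Nil
    then show ?case by (simp add: generate.one)
  next
    case (Cons y ys)
    have y: "y \<in> carrier G" and p: "foldr (\<otimes>) ys \<one> \<in> carrier G" using Cons.prems Y fold by auto
    have "cofactor (rep x \<otimes> (y \<otimes> foldr (\<otimes>) ys \<one>)) = cofactor ((rep x \<otimes> y) \<otimes> foldr (\<otimes>) ys \<one>)"
      using y p Cons.prems by (simp add: m_assoc)
    also have "\<dots> = cofactor (rep x \<otimes> y) \<otimes> cofactor (rep (rep x \<otimes> y) \<otimes> foldr (\<otimes>) ys \<one>)"
      using y p Cons.prems by (intro cofactor_mult) auto
    also have "\<dots> \<in> generate G C"
    proof (rule generate.eng)
      show "cofactor (rep x \<otimes> y) \<in> generate G C"
        using Cons.prems by (intro generate.incl) (auto simp: C_def)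
      show "cofactor (rep (rep x \<otimes> y) \<otimes> foldr (\<otimes>) ys \<one>) \<in> generate G C"
        using Cons.prems y by (intro Cons.IH) auto
    qed
    finally show ?case by simp
  qed
  have "B \<subseteq> generate G C"
  proof
    fix b assume b: "b \<in> B"
    then obtain ys where ys: "set ys \<subseteq> Y" "b = foldr (\<otimes>) ys \<one>" using gen B_carrier by blast
    then show "b \<in> generate G C"
      using key[of \<one> ys] b by (simp add: B_carrier cofactor_B)
  qed
  moreover have "finite C" using Y finite_reps by (simp add: C_def)
  ultimately show thesis using that CB by blast
qed

end

lemma (in group) coset_section_exists:
  assumes "finite_index_subgroup B G"
  obtains rep where "coset_section G B rep"
proof -
  have B: "subgroup B G" and fin: "finite (rcosets B)"
    using assms by (auto simp: finite_index_subgroup_def)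
  define f where "f C = (if C = B then \<one> else (SOME y. y \<in> C))" for C
  define rep where "rep x = f (B #> x)" for x
  have mem: "rep x \<in> B #> x" if x: "x \<in> carrier G" for x
    using x B rcos_self[OF x B] subgroup.one_closed[OF B] someI[of "\<lambda>y. y \<in> B #> x" x]
    by (auto simp: rep_def f_def)
  have clos: "rep x \<in> carrier G" if x: "x \<in> carrier G" for x
    using mem[OF x] r_coset_subset_G[OF subgroup.subset[OF B] x] by auto
  have "coset_section G B rep"
  proof (intro coset_section.intro coset_section_axioms.intro)
    show "group G" by (rule is_group)
    show "subgroup B G" by fact
    show "rep x \<in> carrier G" if "x \<in> carrier G" for x using clos that .
    show "x \<otimes> inv rep x \<in> B" if x: "x \<in> carrier G" for x
    proof -
      obtain b where b: "b \<in> B" "rep x = b \<otimes> x" using mem[OF x] by (auto simp: r_coset_def)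
      then have "x \<otimes> inv rep x = inv b"
        using x subgroup.mem_carrier[OF B] by (simp add: inv_mult_group m_assoc[symmetric])
      then show ?thesis using b B by (simp add: subgroup.m_inv_closed)
    qed
    show "rep (b \<otimes> x) = rep x" if b: "b \<in> B" "x \<in> carrier G" for b x
    proof -
      have "b \<otimes> x \<in> B #> x" using b by (auto simp: r_coset_def)
      then show ?thesis using repr_independence[OF _ b(2) B] by (simp add: rep_def)
    qed
    show "rep \<one> = \<one>" using B by (simp add: rep_def f_def coset_mult_one subgroup.subset)
    have "rep ` carrier G \<subseteq> f ` (rcosets B)" by (auto simp: rep_def RCOSETS_def)
    then show "finite (rep ` carrier G)" using fin finite_surj by blast
  qed
  then show thesis using that by blast
qed

section \<open>Embeddings from homomorphisms of abelian groups\<close>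

text \<open>
  Take a maximal subset of \<open>T\<close> on whose span \<open>\<psi>\<close> is injective. The image of its span has finite index
  in the image of the span of \<open>T\<close>: adding a further generator \<open>t\<close> creates a kernel element, so a positive power of \<open>\<psi> t\<close> was in the image already.
  The induction carries along a covering by finitely many translates of the image, because this
  composes without mentioning the intermediate subgroups.
\<close>
lemma injective_finite_index_lift:
  fixes R (structure) and H :: "('h, 'd) monoid_scheme" and \<psi>
  assumes "comm_group R" "group H" and hom: "\<psi> \<in> hom R H"
    and T: "finite T" "T \<subseteq> carrier R"
  shows "\<exists>U F. subgroup U R \<and> inj_on \<psi> U \<and> finite F \<and> F \<subseteq> carrier H
    \<and> \<psi> ` generate R T \<subseteq> \<psi> ` U <#>\<^bsub>H\<^esub> F"
  using T
proof (induction T rule: finite_induct)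
  interpret R: comm_group R by fact
  interpret H: group H by fact
  interpret \<psi>: group_hom R H \<psi> by unfold_locales (rule hom)
  {
    case empty
    show ?case
      by (intro exI[of _ "{\<one>}"] exI[of _ "{\<one>\<^bsub>H\<^esub>}"])
        (auto simp: R.generate_empty R.triv_subgroup set_mult_def)
  next
    case (insert t T)
    have t: "t \<in> carrier R" and TR: "T \<subseteq> carrier R" using insert.prems by auto
    obtain U F where U: "subgroup U R" and inj: "inj_on \<psi> U" and F: "finite F" "F \<subseteq> carrier H"
      and cov: "\<psi> ` generate R T \<subseteq> \<psi> ` U <#>\<^bsub>H\<^esub> F"
      using insert.IH[OF TR] by blast
    note Uc = subgroup.mem_carrier[OF U]
    define P where "P = generate R {t}"
    have P: "P = range (\<lambda>k::int. t [^] k)" unfolding P_def R.generate_pow[OF t] by auto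
    have subP: "subgroup P R" unfolding P_def using t by (intro R.generate_is_subgroup) simp
    have subT: "subgroup (generate R T) R" using TR by (rule R.generate_is_subgroup)
    define V where "V = P <#> U"
    have V: "subgroup V R" unfolding V_def by (rule R.mult_subgroups[OF subP U])
    have gen: "generate R (insert t T) \<subseteq> P <#> generate R T"
    proof (rule R.generate_subgroup_incl)
      show "subgroup (P <#> generate R T) R" by (rule R.mult_subgroups[OF subP subT])
      have "t = t \<otimes> \<one>" using t by simp
      moreover have "x = \<one> \<otimes> x" if "x \<in> T" for x using that TR by auto
      moreover have "t \<in> P" by (simp add: P_def generate.incl)
      moreover have "\<one> \<in> P" "\<one> \<in> generate R T" by (simp_all add: P_def generate.one)
      moreover have "x \<in> generate R T" if "x \<in> T" for x using that by (rule generate.incl)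
      ultimately show "insert t T \<subseteq> P <#> generate R T"
        unfolding set_mult_def by blast
    qed
    show ?case
    proof (cases "inj_on \<psi> V")
      case True
      have "\<psi> ` generate R (insert t T) \<subseteq> \<psi> ` V <#>\<^bsub>H\<^esub> F"
      proof
        fix y assume "y \<in> \<psi> ` generate R (insert t T)"
        then obtain p z where pz: "p \<in> P" "z \<in> generate R T" "y = \<psi> (p \<otimes> z)"
          using gen unfolding set_mult_def by blast
        obtain u f where uf: "u \<in> U" "f \<in> F" "\<psi> z = \<psi> u \<otimes>\<^bsub>H\<^esub> f"
          using cov pz(2) by (force simp: set_mult_def)
        have c: "p \<in> carrier R" "z \<in> carrier R" "u \<in> carrier R" "f \<in> carrier H"
          using subgroup.mem_carrier[OF subP] subgroup.mem_carrier[OF subT] Uc F pz uf by auto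
        have "y = \<psi> (p \<otimes> u) \<otimes>\<^bsub>H\<^esub> f" using pz uf c by (simp add: H.m_assoc)
        moreover have "p \<otimes> u \<in> V" using pz uf by (auto simp: V_def set_mult_def)
        ultimately show "y \<in> \<psi> ` V <#>\<^bsub>H\<^esub> F" using uf by (auto simp: set_mult_def)
      qed
      then show ?thesis using V True F by blast
    next
      case False
      \<comment> \<open>A kernel element of \<open>V\<close> must involve \<open>t\<close>, so a positive power of \<open>\<psi> t\<close> already lies in the image of \<open>U\<close>.\<close>
      obtain x y where xy: "x \<in> V" "y \<in> V" "\<psi> x = \<psi> y" "x \<noteq> y"
        using False by (auto simp: inj_on_def)
      have xyc: "x \<in> carrier R" "y \<in> carrier R" using xy subgroup.mem_carrier[OF V] by auto
      have "x \<otimes> inv y \<in> V" using xy V by (simp add: subgroup.m_closed subgroup.m_inv_closed)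
      then obtain p u where pu: "p \<in> P" "u \<in> U" "x \<otimes> inv y = p \<otimes> u"
        by (auto simp: V_def set_mult_def)
      obtain a :: int where a: "p = t [^] a" using pu P by auto
      have "\<psi> (p \<otimes> u) = \<one>\<^bsub>H\<^esub>" using xy xyc by (simp flip: pu(3))
      moreover have ne: "p \<otimes> u \<noteq> \<one>" using xy xyc pu by (metis R.inv_equality R.inv_inv R.inv_closed)
      moreover have "p \<in> carrier R" "u \<in> carrier R" using a t pu Uc by auto
      ultimately have pu': "\<psi> p = \<psi> (inv u)"
        using H.inv_equality[of "\<psi> p" "\<psi> u"] by simp
      have a0: "a \<noteq> 0"
      proof
        assume "a = 0"
        then have "p = \<one>" using a by simp
        then have "\<psi> u = \<psi> \<one>" "u \<noteq> \<one>" using pu' ne \<open>u \<in> carrier R\<close> \<open>\<psi> (p \<otimes> u) = \<one>\<^bsub>H\<^esub>\<close> by auto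
        then show False using inj pu(2) subgroup.one_closed[OF U] by (auto simp: inj_on_def)
      qed
      have img: "subgroup (\<psi> ` U) H" by (rule \<psi>.subgroup_img_is_subgroup[OF U])
      define k where "k = \<bar>a\<bar>"
      have k: "k > 0" using a0 by (simp add: k_def)
      have "\<psi> p \<in> \<psi> ` U" using pu' pu(2) U by (simp add: subgroup.m_inv_closed)
      then have "\<psi> (t [^] k) \<in> \<psi> ` U"
        using a t subgroup.m_inv_closed[OF img] by (auto simp: k_def abs_if R.int_pow_neg)
      then have kpow: "\<psi> ((t [^] k) [^] m) \<in> \<psi> ` U" for m :: int
        using H.subgroup_int_pow_closed[OF img] t \<psi>.hom_int_pow[of "t [^] k"] by auto
      define F' where "F' = (\<lambda>(j, f). \<psi> (t [^] j) \<otimes>\<^bsub>H\<^esub> f) ` ({0..<k} \<times> F)"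
      have "\<psi> ` generate R (insert t T) \<subseteq> \<psi> ` U <#>\<^bsub>H\<^esub> F'"
      proof
        fix y assume "y \<in> \<psi> ` generate R (insert t T)"
        then obtain p z where pz: "p \<in> P" "z \<in> generate R T" "y = \<psi> (p \<otimes> z)"
          using gen unfolding set_mult_def by blast
        obtain b :: int where b: "p = t [^] b" using pz P by auto
        obtain u f where uf: "u \<in> U" "f \<in> F" "\<psi> z = \<psi> u \<otimes>\<^bsub>H\<^esub> f"
          using cov pz(2) by (force simp: set_mult_def)
        have c: "z \<in> carrier R" "u \<in> carrier R" "f \<in> carrier H"
          using subgroup.mem_carrier[OF subT] Uc F pz uf by auto
        define w where "w = (t [^] k) [^] (b div k)"
        have w: "w \<in> carrier R" using t by (simp add: w_def)
        have "p = t [^] (k * (b div k) + b mod k)" using b by simp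
        also have "\<dots> = w \<otimes> t [^] (b mod k)"
          unfolding w_def using t by (simp only: R.int_pow_mult R.int_pow_pow)
        finally have "p = w \<otimes> t [^] (b mod k)" .
        then have "\<psi> p = \<psi> w \<otimes>\<^bsub>H\<^esub> \<psi> (t [^] (b mod k))" using w t by simp
        then have "y = \<psi> w \<otimes>\<^bsub>H\<^esub> (\<psi> (t [^] (b mod k) \<otimes> u) \<otimes>\<^bsub>H\<^esub> f)"
          using pz b c w t uf by (simp add: H.m_assoc)
        also have "t [^] (b mod k) \<otimes> u = u \<otimes> t [^] (b mod k)" using c t by (simp add: R.m_comm)
        finally have y: "y = (\<psi> w \<otimes>\<^bsub>H\<^esub> \<psi> u) \<otimes>\<^bsub>H\<^esub> (\<psi> (t [^] (b mod k)) \<otimes>\<^bsub>H\<^esub> f)"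
          using c w t by (simp add: H.m_assoc)
        have "\<psi> w \<otimes>\<^bsub>H\<^esub> \<psi> u \<in> \<psi> ` U"
          using kpow uf(1) by (intro subgroup.m_closed[OF img]) (auto simp: w_def)
        moreover have "\<psi> (t [^] (b mod k)) \<otimes>\<^bsub>H\<^esub> f \<in> F'"
          using k uf by (force simp: F'_def)
        ultimately show "y \<in> \<psi> ` U <#>\<^bsub>H\<^esub> F'" using y unfolding set_mult_def by blast
      qed
      moreover have "finite F'" "F' \<subseteq> carrier H" using F t by (auto simp: F'_def)
      ultimately show ?thesis using U inj by blast
    qed
  }
qed

text \<open>
  A homomorphism between subgroups of \<open>K\<close> and \<open>H\<close> is represented by its graph \<open>R\<close>. Since \<open>R\<close> is
  functional and \<open>K\<close> is abelian, \<open>R\<close> is an abelian group, and a subgroup of \<open>R\<close> on which the second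
  projection is injective is the graph of an isomorphism that can be read backwards.
\<close>
lemma embedding_of_functional_relation:
  fixes K :: "('k, 'c) monoid_scheme" and H :: "('h, 'd) monoid_scheme"
  assumes "comm_group K" "group H"
    and R: "subgroup R (K \<times>\<times> H)"
    and functional: "\<And>g x y. (g, x) \<in> R \<Longrightarrow> (g, y) \<in> R \<Longrightarrow> x = y"
    and fin: "finite (rcosets\<^bsub>H\<^esub> (snd ` R))"
    and Y: "finite Y" "Y \<subseteq> carrier H"
    and gen: "\<And>h. h \<in> carrier H \<Longrightarrow> \<exists>ys. set ys \<subseteq> Y \<and> h = foldr (\<otimes>\<^bsub>H\<^esub>) ys \<one>\<^bsub>H\<^esub>"
  shows "\<exists>L \<phi>. finite_index_subgroup L H \<and> \<phi> \<in> mon (H\<lparr>carrier := L\<rparr>) K"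
proof -
  interpret K: comm_group K by fact
  interpret H: group H by fact
  interpret KH: group "K \<times>\<times> H" using K.is_group H.is_group by (rule DirProd_group)
  define RG where "RG = (K \<times>\<times> H)\<lparr>carrier := R\<rparr>"
  have RG: "group RG" unfolding RG_def by (rule KH.subgroup_imp_group[OF R])
  have Rc: "g \<in> carrier K \<and> x \<in> carrier H" if "(g, x) \<in> R" for g x
    using subgroup.subset[OF R] that by auto
  have Rm: "(g \<otimes>\<^bsub>K\<^esub> g', x \<otimes>\<^bsub>H\<^esub> x') \<in> R" if "(g, x) \<in> R" "(g', x') \<in> R" for g g' x x'
    using subgroup.m_closed[OF R that] by simp
  interpret RG: comm_group RG
  proof (rule group.group_comm_groupI[OF RG])
    fix p q assume "p \<in> carrier RG" "q \<in> carrier RG"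
    moreover obtain g x g' x' where "p = (g, x)" "q = (g', x')" by fastforce
    ultimately have pq: "p = (g, x)" "q = (g', x')" "(g, x) \<in> R" "(g', x') \<in> R"
      by (simp_all add: RG_def)
    have "g \<otimes>\<^bsub>K\<^esub> g' = g' \<otimes>\<^bsub>K\<^esub> g" using pq Rc by (simp add: K.m_comm)
    then have "x \<otimes>\<^bsub>H\<^esub> x' = x' \<otimes>\<^bsub>H\<^esub> x" using functional Rm pq by metis
    then show "p \<otimes>\<^bsub>RG\<^esub> q = q \<otimes>\<^bsub>RG\<^esub> p"
      using \<open>g \<otimes>\<^bsub>K\<^esub> g' = g' \<otimes>\<^bsub>K\<^esub> g\<close> pq by (simp add: RG_def)
  qed
  have carR: "carrier RG = R" by (simp add: RG_def)
  have hom: "snd \<in> hom RG H" using Rc by (auto simp: hom_def RG_def)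
  interpret snd: group_hom RG H snd by unfold_locales (rule hom)
  have A: "subgroup (snd ` R) H" using snd.img_is_subgroup by (simp add: carR)
  obtain rep where "coset_section H (snd ` R) rep"
    using H.coset_section_exists[of "snd ` R"] A fin by (auto simp: finite_index_subgroup_def)
  then interpret cs: coset_section H "snd ` R" rep .
  obtain C where C: "finite C" "C \<subseteq> snd ` R" "snd ` R \<subseteq> generate H C"
    using cs.schreier[OF Y gen] by auto
  obtain T where T: "T \<subseteq> R" "finite T" "C = snd ` T"
    using finite_subset_image[OF C(1,2)] by auto
  obtain U F where U: "subgroup U RG" "inj_on snd U" and F: "finite F" "F \<subseteq> carrier H"
    and cov: "snd ` generate RG T \<subseteq> snd ` U <#>\<^bsub>H\<^esub> F"
    using injective_finite_index_lift[OF RG.comm_group_axioms H.is_group hom T(2)] T(1) carR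
    by auto
  have UR: "U \<subseteq> R" using subgroup.subset[OF U(1)] carR by simp
  have Um: "(g \<otimes>\<^bsub>K\<^esub> g', x \<otimes>\<^bsub>H\<^esub> x') \<in> U" if "(g, x) \<in> U" "(g', x') \<in> U" for g g' x x'
    using subgroup.m_closed[OF U(1) that] by (simp add: RG_def)
  have subT: "subgroup (generate RG T) RG" using T carR by (intro RG.generate_is_subgroup) simp
  have "generate H C \<subseteq> snd ` generate RG T"
    using T(3) snd.subgroup_img_is_subgroup[OF subT]
    by (intro H.generate_subgroup_incl) (auto simp: generate.incl)
  then have AU: "snd ` R \<subseteq> snd ` U <#>\<^bsub>H\<^esub> F" using C(3) cov by blast
  obtain F0 where F0: "finite F0" "F0 \<subseteq> carrier H" "carrier H \<subseteq> snd ` R <#>\<^bsub>H\<^esub> F0"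
    using H.cover_of_finite_rcosets[OF A fin] by blast
  have L: "subgroup (snd ` U) H" by (rule snd.subgroup_img_is_subgroup[OF U(1)])
  have "carrier H \<subseteq> (snd ` U <#>\<^bsub>H\<^esub> F) <#>\<^bsub>H\<^esub> F0"
    using F0(3) mono_set_mult[OF AU order.refl[of F0], of H] by (rule order.trans)
  then have "carrier H \<subseteq> snd ` U <#>\<^bsub>H\<^esub> (F <#>\<^bsub>H\<^esub> F0)"
    using H.set_mult_assoc[OF subgroup.subset[OF L] F(2) F0(2)] by simp
  moreover have "finite (F <#>\<^bsub>H\<^esub> F0)" using F(1) F0(1) by (simp add: set_mult_def)
  moreover have "F <#>\<^bsub>H\<^esub> F0 \<subseteq> carrier H" using F(2) F0(2) by (rule H.set_mult_closed)
  ultimately have "finite (rcosets\<^bsub>H\<^esub> (snd ` U))"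
    using H.finite_rcosets_of_cover[OF L] by blast
  then have fi: "finite_index_subgroup (snd ` U) H" using L by (simp add: finite_index_subgroup_def)
  define \<phi> where "\<phi> y = fst (inv_into U snd y)" for y
  have \<phi>: "\<phi> x = g" if "(g, x) \<in> U" for g x
    using inv_into_f_f[OF U(2) that] by (simp add: \<phi>_def)
  have "\<phi> \<in> mon (H\<lparr>carrier := snd ` U\<rparr>) K"
    unfolding mon_def
  proof (intro CollectI conjI homI)
    fix x y assume "x \<in> carrier (H\<lparr>carrier := snd ` U\<rparr>)" "y \<in> carrier (H\<lparr>carrier := snd ` U\<rparr>)"
    then obtain g g' where gg: "(g, x) \<in> U" "(g', y) \<in> U" by auto
    show "\<phi> (x \<otimes>\<^bsub>H\<lparr>carrier := snd ` U\<rparr>\<^esub> y) = \<phi> x \<otimes>\<^bsub>K\<^esub> \<phi> y"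
      using \<phi>[OF gg(1)] \<phi>[OF gg(2)] \<phi>[OF Um[OF gg]] by simp
    show "\<phi> x \<in> carrier K" using \<phi>[OF gg(1)] gg(1) UR Rc by auto
  next
    show "inj_on \<phi> (carrier (H\<lparr>carrier := snd ` U\<rparr>))"
    proof (rule inj_onI)
      fix x y assume "x \<in> carrier (H\<lparr>carrier := snd ` U\<rparr>)" "y \<in> carrier (H\<lparr>carrier := snd ` U\<rparr>)"
        and eq: "\<phi> x = \<phi> y"
      then obtain g g' where gg: "(g, x) \<in> U" "(g', y) \<in> U" by auto
      then have "g = g'" using \<phi> eq by metis
      then show "x = y" using functional gg UR by blast
    qed
  qed
  then show ?thesis using fi by blast
qed

text \<open>
  Functionality makes the second components commute with each other, since the two products of two
  pairs have the same first component. Hence the componentwise quotients of pairs are closed under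
  multiplication, and cross-multiplying shows that a quotient of first components determines the
  quotient of second components.
\<close>
lemma subgroup_of_fractions:
  fixes K :: "('k, 'c) monoid_scheme" and H :: "('h, 'd) monoid_scheme"
  assumes "comm_group K" "group H"
    and M: "M \<subseteq> carrier K \<times> carrier H" "(\<one>\<^bsub>K\<^esub>, \<one>\<^bsub>H\<^esub>) \<in> M"
    and mult: "\<And>g x g' x'. (g, x) \<in> M \<Longrightarrow> (g', x') \<in> M \<Longrightarrow> (g \<otimes>\<^bsub>K\<^esub> g', x \<otimes>\<^bsub>H\<^esub> x') \<in> M"
    and functional: "\<And>g x y. (g, x) \<in> M \<Longrightarrow> (g, y) \<in> M \<Longrightarrow> x = y"
  obtains R where "subgroup R (K \<times>\<times> H)" "M \<subseteq> R"
    "\<And>g x y. (g, x) \<in> R \<Longrightarrow> (g, y) \<in> R \<Longrightarrow> x = y"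
proof -
  interpret K: comm_group K by fact
  interpret H: group H by fact
  interpret KH: group "K \<times>\<times> H" using K.is_group H.is_group by (rule DirProd_group)
  have car: "g \<in> carrier K" "x \<in> carrier H" if "(g, x) \<in> M" for g x using M that by auto
  have comm: "x \<otimes>\<^bsub>H\<^esub> y = y \<otimes>\<^bsub>H\<^esub> x" if "(g, x) \<in> M" "(g', y) \<in> M" for g g' x y
    using functional[OF mult[OF that] ] mult[OF that(2,1)] K.m_comm car that by metis
  have comm_inv: "inv\<^bsub>H\<^esub> x \<otimes>\<^bsub>H\<^esub> y = y \<otimes>\<^bsub>H\<^esub> inv\<^bsub>H\<^esub> x" if "(g, x) \<in> M" "(g', y) \<in> M" for g g' x y
  proof -
    have c: "x \<in> carrier H" "y \<in> carrier H" using that car by auto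
    have "inv\<^bsub>H\<^esub> x \<otimes>\<^bsub>H\<^esub> y = inv\<^bsub>H\<^esub> x \<otimes>\<^bsub>H\<^esub> (y \<otimes>\<^bsub>H\<^esub> x) \<otimes>\<^bsub>H\<^esub> inv\<^bsub>H\<^esub> x"
      using c by (simp add: H.m_assoc)
    also have "\<dots> = inv\<^bsub>H\<^esub> x \<otimes>\<^bsub>H\<^esub> (x \<otimes>\<^bsub>H\<^esub> y) \<otimes>\<^bsub>H\<^esub> inv\<^bsub>H\<^esub> x"
      using comm[OF that] by simp
    also have "\<dots> = y \<otimes>\<^bsub>H\<^esub> inv\<^bsub>H\<^esub> x"
      using c by (simp add: H.m_assoc[symmetric])
    finally show ?thesis .
  qed
  define R where "R = {(g \<otimes>\<^bsub>K\<^esub> inv\<^bsub>K\<^esub> g', x \<otimes>\<^bsub>H\<^esub> inv\<^bsub>H\<^esub> x') | g g' x x'. (g, x) \<in> M \<and> (g', x') \<in> M}"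
  have RI: "(a, b) \<in> R"
    if "(g, x) \<in> M" "(g', x') \<in> M" "a = g \<otimes>\<^bsub>K\<^esub> inv\<^bsub>K\<^esub> g'" "b = x \<otimes>\<^bsub>H\<^esub> inv\<^bsub>H\<^esub> x'" for a b g x g' x'
    using that by (auto simp: R_def)
  have RE: "\<exists>g x g' x'. (g, x) \<in> M \<and> (g', x') \<in> M \<and> a = g \<otimes>\<^bsub>K\<^esub> inv\<^bsub>K\<^esub> g' \<and> b = x \<otimes>\<^bsub>H\<^esub> inv\<^bsub>H\<^esub> x'"
    if "(a, b) \<in> R" for a b
    using that by (auto simp: R_def)
  have "subgroup R (K \<times>\<times> H)"
  proof
    show "R \<subseteq> carrier (K \<times>\<times> H)" using car by (auto simp: R_def)
    show "\<one>\<^bsub>K \<times>\<times> H\<^esub> \<in> R" using RI[OF M(2) M(2)] by simp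
  next
    fix p q assume "p \<in> R" "q \<in> R"
    moreover obtain a b c d where pq: "p = (a, b)" "q = (c, d)" by fastforce
    ultimately obtain g x g' x' l y l' y' where m: "(g, x) \<in> M" "(g', x') \<in> M"
      "a = g \<otimes>\<^bsub>K\<^esub> inv\<^bsub>K\<^esub> g'" "b = x \<otimes>\<^bsub>H\<^esub> inv\<^bsub>H\<^esub> x'"
      "(l, y) \<in> M" "(l', y') \<in> M" "c = l \<otimes>\<^bsub>K\<^esub> inv\<^bsub>K\<^esub> l'" "d = y \<otimes>\<^bsub>H\<^esub> inv\<^bsub>H\<^esub> y'"
      using RE[of a b] RE[of c d] by auto
    note c = car[OF m(1)] car[OF m(2)] car[OF m(5)] car[OF m(6)]
    have "a \<otimes>\<^bsub>K\<^esub> c = (g \<otimes>\<^bsub>K\<^esub> l) \<otimes>\<^bsub>K\<^esub> inv\<^bsub>K\<^esub> (g' \<otimes>\<^bsub>K\<^esub> l')"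
      using c m by (simp add: K.inv_mult K.m_ac)
    moreover have "b \<otimes>\<^bsub>H\<^esub> d = (x \<otimes>\<^bsub>H\<^esub> y) \<otimes>\<^bsub>H\<^esub> inv\<^bsub>H\<^esub> (x' \<otimes>\<^bsub>H\<^esub> y')"
    proof -
      have "b \<otimes>\<^bsub>H\<^esub> d = x \<otimes>\<^bsub>H\<^esub> (inv\<^bsub>H\<^esub> x' \<otimes>\<^bsub>H\<^esub> y) \<otimes>\<^bsub>H\<^esub> inv\<^bsub>H\<^esub> y'"
        using c m by (simp add: H.m_assoc)
      also have "\<dots> = (x \<otimes>\<^bsub>H\<^esub> y) \<otimes>\<^bsub>H\<^esub> (inv\<^bsub>H\<^esub> x' \<otimes>\<^bsub>H\<^esub> inv\<^bsub>H\<^esub> y')"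
        using c comm_inv[OF m(2,5)] by (simp add: H.m_assoc)
      also have "inv\<^bsub>H\<^esub> x' \<otimes>\<^bsub>H\<^esub> inv\<^bsub>H\<^esub> y' = inv\<^bsub>H\<^esub> (x' \<otimes>\<^bsub>H\<^esub> y')"
        using c comm[OF m(2,6)] by (simp add: H.inv_mult_group)
      finally show ?thesis .
    qed
    ultimately show "p \<otimes>\<^bsub>K \<times>\<times> H\<^esub> q \<in> R"
      using RI[OF mult[OF m(1,5)] mult[OF m(2,6)]] pq by simp
  next
    fix p assume "p \<in> R"
    moreover obtain a b where p: "p = (a, b)" by fastforce
    ultimately obtain g x g' x' where m: "(g, x) \<in> M" "(g', x') \<in> M"
      "a = g \<otimes>\<^bsub>K\<^esub> inv\<^bsub>K\<^esub> g'" "b = x \<otimes>\<^bsub>H\<^esub> inv\<^bsub>H\<^esub> x'"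
      using RE[of a b] by auto
    note c = car[OF m(1)] car[OF m(2)]
    have "inv\<^bsub>K \<times>\<times> H\<^esub> p = (inv\<^bsub>K\<^esub> a, inv\<^bsub>H\<^esub> b)"
      using p m c by (simp add: inv_DirProd[OF K.is_group H.is_group])
    moreover have "inv\<^bsub>K\<^esub> a = g' \<otimes>\<^bsub>K\<^esub> inv\<^bsub>K\<^esub> g" "inv\<^bsub>H\<^esub> b = x' \<otimes>\<^bsub>H\<^esub> inv\<^bsub>H\<^esub> x"
      using m c by (simp_all add: K.inv_mult_group H.inv_mult_group)
    ultimately show "inv\<^bsub>K \<times>\<times> H\<^esub> p \<in> R" using RI[OF m(2,1)] by simp
  qed
  moreover have "M \<subseteq> R"
  proof
    fix p assume p: "p \<in> M"
    obtain a b where ab: "p = (a, b)" by fastforce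
    show "p \<in> R" using RI[of a b, OF _ M(2)] p ab car[of a b] by simp
  qed
  moreover have "b = d" if ab: "(a, b) \<in> R" and ad: "(a, d) \<in> R" for a b d
  proof -
    obtain g x g' x' l y l' y' where m: "(g, x) \<in> M" "(g', x') \<in> M"
      "a = g \<otimes>\<^bsub>K\<^esub> inv\<^bsub>K\<^esub> g'" "b = x \<otimes>\<^bsub>H\<^esub> inv\<^bsub>H\<^esub> x'"
      "(l, y) \<in> M" "(l', y') \<in> M" "a = l \<otimes>\<^bsub>K\<^esub> inv\<^bsub>K\<^esub> l'" "d = y \<otimes>\<^bsub>H\<^esub> inv\<^bsub>H\<^esub> y'"
      using RE[OF ab] RE[OF ad] by auto
    note c = car[OF m(1)] car[OF m(2)] car[OF m(5)] car[OF m(6)]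
    have "g \<otimes>\<^bsub>K\<^esub> l' = (g \<otimes>\<^bsub>K\<^esub> inv\<^bsub>K\<^esub> g') \<otimes>\<^bsub>K\<^esub> (g' \<otimes>\<^bsub>K\<^esub> l')"
      using c by (simp add: K.m_assoc K.inv_solve_left)
    also have "\<dots> = (l \<otimes>\<^bsub>K\<^esub> inv\<^bsub>K\<^esub> l') \<otimes>\<^bsub>K\<^esub> (l' \<otimes>\<^bsub>K\<^esub> g')"
      using m c by (simp add: K.m_comm)
    also have "\<dots> = l \<otimes>\<^bsub>K\<^esub> (inv\<^bsub>K\<^esub> l' \<otimes>\<^bsub>K\<^esub> l') \<otimes>\<^bsub>K\<^esub> g'"
      using c by (simp only: K.m_assoc K.m_closed K.inv_closed)
    also have "\<dots> = l \<otimes>\<^bsub>K\<^esub> g'" using c by simp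
    finally have "g \<otimes>\<^bsub>K\<^esub> l' = l \<otimes>\<^bsub>K\<^esub> g'" .
    then have xy: "x \<otimes>\<^bsub>H\<^esub> y' = y \<otimes>\<^bsub>H\<^esub> x'"
      using functional mult[OF m(1,6)] mult[OF m(5,2)] by metis
    have "b = (x \<otimes>\<^bsub>H\<^esub> y') \<otimes>\<^bsub>H\<^esub> inv\<^bsub>H\<^esub> y' \<otimes>\<^bsub>H\<^esub> inv\<^bsub>H\<^esub> x'"
      using m c by (simp add: H.m_assoc)
    also have "\<dots> = y \<otimes>\<^bsub>H\<^esub> (x' \<otimes>\<^bsub>H\<^esub> (inv\<^bsub>H\<^esub> y' \<otimes>\<^bsub>H\<^esub> inv\<^bsub>H\<^esub> x'))"
      using xy c by (simp add: H.m_assoc)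
    also have "inv\<^bsub>H\<^esub> y' \<otimes>\<^bsub>H\<^esub> inv\<^bsub>H\<^esub> x' = inv\<^bsub>H\<^esub> (x' \<otimes>\<^bsub>H\<^esub> y')"
      using c by (simp add: H.inv_mult_group)
    also have "\<dots> = inv\<^bsub>H\<^esub> x' \<otimes>\<^bsub>H\<^esub> inv\<^bsub>H\<^esub> y'"
      unfolding comm[OF m(2,6)] using c by (simp add: H.inv_mult_group)
    also have "y \<otimes>\<^bsub>H\<^esub> (x' \<otimes>\<^bsub>H\<^esub> (inv\<^bsub>H\<^esub> x' \<otimes>\<^bsub>H\<^esub> inv\<^bsub>H\<^esub> y')) = d"
      using c m by (simp add: H.m_assoc[symmetric])
    finally show ?thesis .
  qed
  ultimately show thesis using that by blast
qed

section \<open>Dickson's lemma\<close>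

lemma nat_sequence_incseq_subseq:
  fixes s :: "nat \<Rightarrow> nat"
  obtains r :: "nat \<Rightarrow> nat" where "strict_mono r" "mono (\<lambda>n. s (r n))"
proof -
  obtain f :: "nat \<Rightarrow> nat" where f: "strict_mono f" "monoseq (\<lambda>n. s (f n))" using seq_monosub by blast
  show thesis
  proof (cases "incseq (\<lambda>n. s (f n))")
    case True
    then show ?thesis using that f by blast
  next
    case False
    then have dec: "decseq (\<lambda>n. s (f n))" using f(2) by (simp add: monoseq_iff)
    obtain N where N: "\<And>n. s (f N) \<le> s (f n)"
      using ex_has_least_nat[of "\<lambda>_. True" 0 "\<lambda>n. s (f n)"] by auto
    have const: "s (f (N + n)) = s (f N)" for n
      using N[of "N + n"] decseqD[OF dec, of N "N + n"] by simp
    have "strict_mono (\<lambda>n. f (N + n))"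
      by (intro strict_monoI strict_monoD[OF f(1)]) simp
    moreover have "mono (\<lambda>n. s (f (N + n)))" using const by (simp add: mono_def)
    ultimately show ?thesis by (rule that)
  qed
qed

lemma dickson_subseq:
  fixes M :: "nat \<Rightarrow> 'e multiset"
  assumes "finite E"
  shows "\<exists>r :: nat \<Rightarrow> nat. strict_mono r \<and> (\<forall>e\<in>E. mono (\<lambda>n. count (M (r n)) e))"
  using assms
proof (induction E rule: finite_induct)
  case empty
  show ?case by (rule exI[of _ "\<lambda>n. n"]) (simp add: strict_mono_def)
next
  case (insert e E)
  then obtain r :: "nat \<Rightarrow> nat" where r: "strict_mono r" "\<forall>e\<in>E. mono (\<lambda>n. count (M (r n)) e)" by blast
  obtain f :: "nat \<Rightarrow> nat" where f: "strict_mono f" "mono (\<lambda>n. count (M (r (f n))) e)"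
    using nat_sequence_incseq_subseq[of "\<lambda>n. count (M (r n)) e"] by blast
  have "mono (\<lambda>n. count (M (r (f n))) d)" if "d \<in> E" for d
    using r(2) that strict_mono_mono[OF f(1)] unfolding mono_def by blast
  moreover have "strict_mono (\<lambda>n. r (f n))"
    by (intro strict_monoI strict_monoD[OF r(1)] strict_monoD[OF f(1)])
  ultimately show ?case using f(2) by (intro exI[of _ "\<lambda>n. r (f n)"]) auto
qed

text \<open>
  Besides comparability of multisets, the later index can be forced to exceed any bound \<open>b\<close> that depends on the
  earlier one, and both to have the same colour: all this holds along an infinite monotone
  subsequence.
\<close>
lemma dickson_pair:
  fixes M :: "nat \<Rightarrow> 'e multiset" and c :: "nat \<Rightarrow> 'c" and b :: "nat \<Rightarrow> nat"
  assumes E: "finite E" "\<And>n. set_mset (M n) \<subseteq> E" and c: "finite (range c)"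
  obtains i n where "b i \<le> n" "c i = c n" "M i \<subseteq># M n"
proof -
  obtain r :: "nat \<Rightarrow> nat" where r: "strict_mono r" "\<forall>e\<in>E. mono (\<lambda>n. count (M (r n)) e)"
    using dickson_subseq[OF E(1), of M] by blast
  have le: "M (r i) \<subseteq># M (r j)" if "i \<le> j" for i j
  proof (rule mset_subset_eqI)
    fix e show "count (M (r i)) e \<le> count (M (r j)) e"
    proof (cases "e \<in> E")
      case True
      then show ?thesis using r(2) that by (auto simp: mono_def)
    next
      case False
      then have "count (M (r i)) e = 0" using E(2) by (meson count_eq_zero_iff subsetD)
      then show ?thesis by simp
    qed
  qed
  have "finite ((\<lambda>n. c (r n)) ` UNIV)" using c by (rule finite_subset[rotated]) auto
  then obtain i where i: "infinite {j. c (r j) = c (r i)}"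
    using pigeonhole_infinite[of "UNIV::nat set" "\<lambda>n. c (r n)"] by auto
  have "\<not> {j. c (r j) = c (r i)} \<subseteq> {..max i (b (r i))}"
    using i finite_subset by blast
  then obtain j where "j \<notin> {..max i (b (r i))}" and jc: "c (r j) = c (r i)" by blast
  then have j: "j > i" "j > b (r i)" by auto
  have "b (r i) \<le> r j" using j(2) strict_mono_imp_increasing[OF r(1), of j] by linarith
  then show thesis using jc[symmetric] le[OF less_imp_le[OF j(1)]] by (rule that)
qed

lemma mset_slice:
  assumes "b \<le> length xs"
  shows "mset (drop a (take b xs)) = image_mset ((!) xs) (mset_set {a..<b})"
proof -
  have "drop a (take b xs) = map ((!) xs) [a..<b]"
    using assms by (intro nth_equalityI) auto
  then show ?thesis by simp
qed

text \<open>
  A submultiset of a list is realised at concrete positions, which makes it possible to say which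
  segments of the list avoid it.
\<close>
lemma sub_mset_positions:
  assumes "mset ys \<subseteq># mset xs"
  obtains P where "P \<subseteq> {..<length xs}" "card P = length ys"
    "image_mset ((!) xs) (mset_set P) = mset ys"
proof -
  obtain zs where "mset xs = mset ys + mset zs"
    using assms by (metis ex_mset subset_mset.add_diff_inverse)
  then have "mset (ys @ zs) = mset xs" by simp
  then obtain p where p: "p permutes {..<length xs}" "permute_list p xs = ys @ zs"
    by (rule mset_eq_permutation)
  have len: "length ys \<le> length xs" using arg_cong[OF p(2), of length] by simp
  have inj: "inj_on p {..<length ys}" using p(1) permutes_inj_on by blast
  define P where "P = p ` {..<length ys}"
  have nth: "xs ! p i = ys ! i" if "i < length ys" for i
    using that p len permute_list_nth[OF p(1), of i] by (simp add: nth_append)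
  have "image_mset ((!) xs) (mset_set P) = image_mset (\<lambda>i. xs ! p i) (mset_set {..<length ys})"
    unfolding P_def image_mset_mset_set[OF inj, symmetric] by (simp add: image_mset.compositionality comp_def)
  also have "\<dots> = image_mset ((!) ys) (mset_set {..<length ys})"
    by (rule image_mset_cong) (simp add: nth)
  also have "\<dots> = mset ys" using mset_slice[of "length ys" ys 0] by (simp add: lessThan_atLeast0)
  finally have "image_mset ((!) xs) (mset_set P) = mset ys" .
  moreover have "P \<subseteq> p ` {..<length xs}" using len by (auto simp: P_def)
  then have "P \<subseteq> {..<length xs}" unfolding permutes_image[OF p(1)] .
  moreover have "card P = length ys" using inj by (simp add: P_def card_image)
  ultimately show thesis using that by blast
qed

section \<open>Walks and balanced multisets of edges\<close>

locale digraph =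
  fixes E :: "'e set" and src tgt :: "'e \<Rightarrow> 'q"
begin

primrec walk :: "'q \<Rightarrow> 'e list \<Rightarrow> 'q \<Rightarrow> bool" where
  "walk p [] q \<longleftrightarrow> p = q"
| "walk p (e # es) q \<longleftrightarrow> e \<in> E \<and> src e = p \<and> walk (tgt e) es q"

lemma walk_append: "walk p (xs @ ys) q \<longleftrightarrow> (\<exists>v. walk p xs v \<and> walk v ys q)"
  by (induction xs arbitrary: p) auto

lemma walk_edges: "walk p es q \<Longrightarrow> set es \<subseteq> E"
  by (induction es arbitrary: p) auto

lemma walk_end: "walk p es q \<Longrightarrow> q \<in> insert p (tgt ` E)"
  by (induction es arbitrary: p) auto

text \<open>
  Conservation of flow: at every vertex the departures of a walk balance its arrivals, up to the two ends.
\<close>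
lemma walk_flow:
  "walk p es q \<Longrightarrow> add_mset q (image_mset src (mset es)) = add_mset p (image_mset tgt (mset es))"
proof (induction es arbitrary: p)
  case (Cons e es)
  then have "add_mset q (image_mset src (mset es)) = add_mset (tgt e) (image_mset tgt (mset es))"
    by auto
  then show ?case using Cons.prems by (auto simp: add_mset_commute)
qed auto

lemma walk_split_at_src:
  assumes "walk p es q" "e \<in> set es"
  obtains xs ys where "es = xs @ ys" "walk p xs (src e)" "walk (src e) ys q"
proof -
  obtain xs ys where "es = xs @ e # ys" using assms(2) by (meson split_list)
  then show thesis using that[of xs "e # ys"] assms(1) by (auto simp: walk_append)
qed

definition balanced :: "'e multiset \<Rightarrow> bool" where
  "balanced Z \<longleftrightarrow> image_mset src Z = image_mset tgt Z"

lemma balanced_closed_walk: "walk v c v \<Longrightarrow> balanced (mset c)"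
  using walk_flow[of v c v] by (simp add: balanced_def)

lemma balanced_diff: "balanced Y \<Longrightarrow> balanced Z \<Longrightarrow> Y \<subseteq># Z \<Longrightarrow> balanced (Z - Y)"
  by (simp add: balanced_def image_mset_Diff)

lemma balanced_walk_diff:
  assumes "walk p xs q" "walk p ys q" "mset xs \<subseteq># mset ys"
  shows "balanced (mset ys - mset xs)"
proof -
  have "image_mset src (mset ys - mset xs) =
      add_mset q (image_mset src (mset ys)) - add_mset q (image_mset src (mset xs))"
    using assms(3) by (simp add: image_mset_Diff)
  also have "\<dots> = image_mset tgt (mset ys - mset xs)"
    unfolding walk_flow[OF assms(1)] walk_flow[OF assms(2)]
    using assms(3) by (simp add: image_mset_Diff)
  finally show ?thesis by (simp add: balanced_def)
qed

text \<open>
  As long as a walk using edges of \<open>Z\<close> has not returned to its start, balance leaves an unused edge of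
  \<open>Z\<close> at its current end.
\<close>
lemma balanced_extend_to_closed_walk:
  assumes Z: "balanced Z" "set_mset Z \<subseteq> E"
    and "walk v c w" "mset c \<subseteq># Z" "c \<noteq> []"
  shows "\<exists>d. d \<noteq> [] \<and> walk v d v \<and> mset d \<subseteq># Z"
  using assms(3-5)
proof (induction "size Z - length c" arbitrary: c w rule: less_induct)
  case less
  show ?case
  proof (cases "w = v")
    case True
    then show ?thesis using less.prems by blast
  next
    case False
    define Y where "Y = Z - mset c"
    have ZY: "Z = Y + mset c" using less.prems(2) by (simp add: Y_def)
    have flow: "add_mset w (image_mset src (mset c)) = add_mset v (image_mset tgt (mset c))"
      by (rule walk_flow) (rule less.prems)
    have "add_mset v (image_mset src Y) + image_mset src (mset c) = add_mset v (image_mset tgt Z)"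
      using Z(1) ZY by (simp add: balanced_def)
    also have "\<dots> = image_mset tgt Y + add_mset v (image_mset tgt (mset c))" using ZY by simp
    also have "\<dots> = add_mset w (image_mset tgt Y) + image_mset src (mset c)"
      by (simp flip: flow)
    finally have "add_mset v (image_mset src Y) = add_mset w (image_mset tgt Y)" by simp
    then have "w \<in># add_mset v (image_mset src Y)" by simp
    then obtain e where e: "e \<in># Y" "src e = w" using False by auto
    have sub: "mset (c @ [e]) \<subseteq># Z" using e(1) ZY by (simp add: subset_mset.add_increasing mset_subset_eq_single)
    have "walk v (c @ [e]) (tgt e)"
      using less.prems(1) e Z(2) ZY by (auto simp: walk_append)
    moreover have "size Z - length (c @ [e]) < size Z - length c"
      using size_mset_mono[OF sub] by simp
    ultimately have "\<exists>d. d \<noteq> [] \<and> walk v d v \<and> mset d \<subseteq># Z"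
      using less.hyps sub by blast
    then show ?thesis .
  qed
qed

text \<open>
  A version of Euler's theorem: a balanced multiset decomposes into closed walks, and each of them can
  be inserted where the given walk meets it. This needs the balanced edges to occur on the walk, so that no
  closed walk is out of reach.
\<close>
lemma walk_absorbs_balanced:
  assumes "walk p xs q" "balanced Z" "set_mset Z \<subseteq> set xs"
  shows "\<exists>ys. walk p ys q \<and> mset ys = mset xs + Z"
  using assms
proof (induction "size Z" arbitrary: Z xs rule: less_induct)
  case less
  show ?case
  proof (cases "Z = {#}")
    case True
    then show ?thesis using less.prems by auto
  next
    case False
    then obtain e where e: "e \<in># Z" by auto
    have ZE: "set_mset Z \<subseteq> E" using less.prems walk_edges by blast
    have "walk (src e) [e] (tgt e)" "mset [e] \<subseteq># Z" using e ZE by auto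
    then obtain c where c: "c \<noteq> []" "walk (src e) c (src e)" "mset c \<subseteq># Z"
      using balanced_extend_to_closed_walk[OF less.prems(2) ZE] by blast
    obtain us vs where uv: "xs = us @ vs" "walk p us (src e)" "walk (src e) vs q"
      using walk_split_at_src[OF less.prems(1)] e less.prems(3) by blast
    have "walk p (us @ c @ vs) q" using uv c by (auto simp: walk_append)
    moreover have "balanced (Z - mset c)"
      using balanced_diff[OF balanced_closed_walk[OF c(2)] less.prems(2) c(3)] .
    moreover have "set_mset (Z - mset c) \<subseteq> set (us @ c @ vs)"
      using less.prems(3) uv(1) by (auto dest: in_diffD)
    moreover have "size (Z - mset c) < size Z"
      using c size_mset_mono[OF c(3)] by (simp add: size_Diff_submset)
        (metis diff_less length_greater_0_conv less_le_trans)
    ultimately obtain ys where ys: "walk p ys q" "mset ys = mset (us @ c @ vs) + (Z - mset c)"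
      using less.hyps by blast
    have "mset ys = mset us + mset vs + (mset c + (Z - mset c))" using ys(2) by simp
    also have "\<dots> = mset xs + Z" using c(3) uv(1) by simp
    finally show ?thesis using ys(1) by blast
  qed
qed

end

section \<open>Automata over abelian groups\<close>

text \<open>
  The labels in \<open>K\<close> and in the free monoid are given by separate functions, so that no form is imposed on the
  edges; \<open>accepts_iff\<close> says that the automaton accepts the word problem of \<open>H\<close>.
\<close>
locale abelian_automaton = digraph E src tgt + K: comm_group K + H: group H
  for E :: "'e set" and src tgt :: "'e \<Rightarrow> 'q"
    and K :: "('k, 'c) monoid_scheme" and H :: "('h, 'd) monoid_scheme" +
  fixes gl :: "'e \<Rightarrow> 'k" and wl :: "'e \<Rightarrow> 'x list" and X :: "'x set" and \<sigma> :: "'x list \<Rightarrow> 'h"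
    and p0 :: 'q and T :: "'q set"
  assumes finite_E: "finite E" and finite_X: "finite X"
    and gl_closed: "e \<in> E \<Longrightarrow> gl e \<in> carrier K"
    and wl_closed: "e \<in> E \<Longrightarrow> wl e \<in> lists X"
    and \<sigma>_mult: "u \<in> lists X \<Longrightarrow> v \<in> lists X \<Longrightarrow> \<sigma> (u @ v) = \<sigma> u \<otimes>\<^bsub>H\<^esub> \<sigma> v"
    and \<sigma>_image: "\<sigma> ` lists X = carrier H"
    and accepts_iff: "w \<in> lists X \<Longrightarrow> \<sigma> w = \<one>\<^bsub>H\<^esub> \<longleftrightarrow>
      (\<exists>t\<in>T. \<exists>es. walk p0 es t \<and> foldr (\<otimes>\<^bsub>K\<^esub>) (map gl es) \<one>\<^bsub>K\<^esub> = \<one>\<^bsub>K\<^esub> \<and> concat (map wl es) = w)"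
begin

definition glab where "glab es = foldr (\<otimes>\<^bsub>K\<^esub>) (map gl es) \<one>\<^bsub>K\<^esub>"
definition wlab where "wlab es = concat (map wl es)"

lemma glab_closed: "set es \<subseteq> E \<Longrightarrow> glab es \<in> carrier K"
  unfolding glab_def using gl_closed by (intro K.multlist_closed) auto

lemma glab_append: "set es \<subseteq> E \<Longrightarrow> set fs \<subseteq> E \<Longrightarrow> glab (es @ fs) = glab es \<otimes>\<^bsub>K\<^esub> glab fs"
proof (induction es)
  case Nil
  then show ?case using glab_closed by (simp add: glab_def)
next
  case (Cons e es)
  then show ?case
    using glab_closed[of es] glab_closed[of fs] gl_closed[of e] by (simp add: glab_def K.m_assoc)
qed

lemma glab_cong_mset:
  assumes "mset es = mset fs" "set es \<subseteq> E"
  shows "glab es = glab fs"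
  unfolding glab_def using assms gl_closed by (intro K.multlist_perm_cong) auto

lemma wlab_append [simp]: "wlab (es @ fs) = wlab es @ wlab fs"
  by (simp add: wlab_def)

lemma wlab_closed: "set es \<subseteq> E \<Longrightarrow> wlab es \<in> lists X"
  using wl_closed by (induction es) (auto simp: wlab_def)

lemma \<sigma>_closed: "w \<in> lists X \<Longrightarrow> \<sigma> w \<in> carrier H"
  using \<sigma>_image by blast

lemma \<sigma>_Nil: "\<sigma> [] = \<one>\<^bsub>H\<^esub>"
proof -
  have "\<sigma> [] \<otimes>\<^bsub>H\<^esub> \<sigma> [] = \<sigma> []" using \<sigma>_mult[of "[]" "[]"] by simp
  then show ?thesis using \<sigma>_closed[of "[]"] H.r_cancel_one'[of "\<sigma> []" "\<sigma> []"] by auto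
qed

lemma sound:
  assumes "t \<in> T" "walk p0 es t" "glab es = \<one>\<^bsub>K\<^esub>"
  shows "\<sigma> (wlab es) = \<one>\<^bsub>H\<^esub>"
  using accepts_iff[OF wlab_closed[OF walk_edges[OF assms(2)]]] assms
  by (auto simp: glab_def wlab_def)

lemma complete:
  assumes "w \<in> lists X" "\<sigma> w = \<one>\<^bsub>H\<^esub>"
  obtains t es where "t \<in> T" "walk p0 es t" "glab es = \<one>\<^bsub>K\<^esub>" "wlab es = w"
  using accepts_iff[OF assms(1)] assms(2) by (auto simp: glab_def wlab_def)

definition accepting_support :: "'e set \<Rightarrow> bool" where
  "accepting_support S \<longleftrightarrow> (\<exists>t\<in>T. \<exists>es. walk p0 es t \<and> glab es = \<one>\<^bsub>K\<^esub> \<and> set es = S)"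

text \<open>
  The available closed walks at \<open>q\<close>. The list \<open>z\<close> serves as a multiset of edges and need not be a walk.
\<close>
definition loops :: "'e set \<Rightarrow> 'q \<Rightarrow> 'e list set" where
  "loops S q = {d. walk q d q \<and> set d \<subseteq> S \<and>
     (\<exists>z. set z \<subseteq> S \<and> balanced (mset z) \<and> glab (d @ z) = \<one>\<^bsub>K\<^esub>)}"

lemma accepting_support_subset: "accepting_support S \<Longrightarrow> S \<subseteq> E"
  unfolding accepting_support_def using walk_edges by blast

lemma Nil_in_loops: "[] \<in> loops S q"
  by (auto simp: loops_def balanced_def glab_def intro!: exI[of _ "[]"])

lemma loops_append:
  assumes S: "S \<subseteq> E" and "c \<in> loops S q" "d \<in> loops S q"
  shows "c @ d \<in> loops S q"
proof -
  obtain y z where y: "set y \<subseteq> S" "balanced (mset y)" "glab (c @ y) = \<one>\<^bsub>K\<^esub>"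
    and z: "set z \<subseteq> S" "balanced (mset z)" "glab (d @ z) = \<one>\<^bsub>K\<^esub>"
    using assms by (auto simp: loops_def)
  have E: "set (c @ y) \<subseteq> E" "set (d @ z) \<subseteq> E" "set ((c @ d) @ (y @ z)) \<subseteq> E"
    using assms y z S by (auto simp: loops_def)
  have "glab ((c @ d) @ (y @ z)) = glab ((c @ y) @ (d @ z))"
    using E(3) by (intro glab_cong_mset) simp_all
  also have "\<dots> = \<one>\<^bsub>K\<^esub>" using E y z by (simp only: glab_append) simp
  finally have "glab ((c @ d) @ (y @ z)) = \<one>\<^bsub>K\<^esub>" .
  moreover have "balanced (mset (y @ z))" using y z by (simp add: balanced_def)
  moreover have "walk q (c @ d) q" using assms by (auto simp: loops_def walk_append)
  ultimately show ?thesis using assms y z unfolding loops_def by (auto intro!: exI[of _ "y @ z"])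
qed

text \<open>
  Weaving the balanced list \<open>z\<close> of \<open>c\<close> into an accepting walk with edge set \<open>S\<close> prepares it for the
  insertion of \<open>c\<close> at \<open>q\<close>. As only the register value of \<open>c\<close> matters for acceptance, \<open>d\<close> fits as well, and
  the two accepted words differ in just this factor.
\<close>
lemma loop_label_determined:
  assumes S: "accepting_support S" and c: "c \<in> loops S q" and d: "d \<in> loops S q"
    and eq: "glab c = glab d"
  shows "\<sigma> (wlab c) = \<sigma> (wlab d)"
proof (cases "c = [] \<and> d = []")
  case False
  \<comment> \<open>A nonempty loop at \<open>q\<close> shows that the accepting walk passes through \<open>q\<close>.\<close>
  have "\<exists>e\<in>S. src e = q"
    using False c d by (cases c; cases d) (auto simp: loops_def)
  then obtain e where e: "e \<in> S" "src e = q" by blast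
  obtain t es where es: "t \<in> T" "walk p0 es t" "glab es = \<one>\<^bsub>K\<^esub>" "set es = S"
    using S by (auto simp: accepting_support_def)
  have SE: "S \<subseteq> E" using S by (rule accepting_support_subset)
  obtain z where z: "set z \<subseteq> S" "balanced (mset z)" "glab (c @ z) = \<one>\<^bsub>K\<^esub>"
    using c by (auto simp: loops_def)
  obtain ys where ys: "walk p0 ys t" "mset ys = mset es + mset z"
    using walk_absorbs_balanced[OF es(2) z(2)] z(1) es(4) by auto
  have "set ys = set es \<union> set z" using arg_cong[OF ys(2), of set_mset] by simp
  then have ysS: "set ys = S" using z(1) es(4) by auto
  then obtain us vs where uv: "ys = us @ vs" "walk p0 us q" "walk q vs t"
    using walk_split_at_src[OF ys(1)] e by blast
  have uvE: "set us \<subseteq> E" "set vs \<subseteq> E" using uv(1) ysS SE by auto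
  have acc: "glab (us @ b @ vs) = \<one>\<^bsub>K\<^esub>" "walk p0 (us @ b @ vs) t" "set b \<subseteq> E"
    if b: "b \<in> loops S q" "glab b = glab c" for b
  proof -
    show bE: "set b \<subseteq> E" using b SE by (auto simp: loops_def)
    have cE: "set c \<subseteq> E" "set z \<subseteq> E" using c z SE by (auto simp: loops_def)
    have "glab (us @ b @ vs) = glab (es @ b @ z)"
      using ys(2) uv(1) uvE bE by (intro glab_cong_mset) (auto simp: ac_simps)
    also have "\<dots> = glab (es @ c @ z)"
      using b(2) bE cE es(4) SE by (simp add: glab_append)
    also have "\<dots> = \<one>\<^bsub>K\<^esub>"
      using z(3) es(3,4) cE SE glab_append[of es "c @ z"] by simp
    finally show "glab (us @ b @ vs) = \<one>\<^bsub>K\<^esub>" .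
    show "walk p0 (us @ b @ vs) t" using b uv by (auto simp: loops_def walk_append)
  qed
  have one: "\<sigma> (wlab us) \<otimes>\<^bsub>H\<^esub> (\<sigma> (wlab b) \<otimes>\<^bsub>H\<^esub> \<sigma> (wlab vs)) = \<one>\<^bsub>H\<^esub>"
    if b: "b \<in> loops S q" "glab b = glab c" for b
    using sound[OF es(1) acc(2,1)[OF b]] wlab_closed[OF acc(3)[OF b]] uvE[THEN wlab_closed]
    by (simp add: \<sigma>_mult)
  have car: "\<sigma> (wlab us) \<in> carrier H" "\<sigma> (wlab vs) \<in> carrier H"
    "\<sigma> (wlab c) \<in> carrier H" "\<sigma> (wlab d) \<in> carrier H"
    using uvE[THEN wlab_closed] wlab_closed[OF acc(3)[OF c refl]] wlab_closed[OF acc(3)[OF d eq[symmetric]]]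
    by (auto intro: \<sigma>_closed)
  have "\<sigma> (wlab us) \<otimes>\<^bsub>H\<^esub> (\<sigma> (wlab c) \<otimes>\<^bsub>H\<^esub> \<sigma> (wlab vs))
      = \<sigma> (wlab us) \<otimes>\<^bsub>H\<^esub> (\<sigma> (wlab d) \<otimes>\<^bsub>H\<^esub> \<sigma> (wlab vs))"
    using one[OF c refl] one[OF d eq[symmetric]] by simp
  then have "\<sigma> (wlab c) \<otimes>\<^bsub>H\<^esub> \<sigma> (wlab vs) = \<sigma> (wlab d) \<otimes>\<^bsub>H\<^esub> \<sigma> (wlab vs)"
    using car by (simp only: H.l_cancel H.m_closed)
  then show ?thesis using car by (simp only: H.r_cancel)
qed simp

text \<open>
  The conjugation by \<open>\<sigma> r\<close> accounts for a walk that stands at \<open>q\<close> after overrunning a prefix of its word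
  by \<open>r\<close>.
\<close>
definition loop_labels :: "'e set \<Rightarrow> 'q \<Rightarrow> 'x list \<Rightarrow> ('k \<times> 'h) set" where
  "loop_labels S q r = (\<lambda>d. (glab d, \<sigma> r \<otimes>\<^bsub>H\<^esub> \<sigma> (wlab d) \<otimes>\<^bsub>H\<^esub> inv\<^bsub>H\<^esub> \<sigma> r)) ` loops S q"

lemma loop_labels_subgroup:
  assumes S: "accepting_support S" and r: "r \<in> lists X"
  obtains R where "subgroup R (K \<times>\<times> H)" "loop_labels S q r \<subseteq> R"
    "\<And>g x y. (g, x) \<in> R \<Longrightarrow> (g, y) \<in> R \<Longrightarrow> x = y"
proof -
  have SE: "S \<subseteq> E" using S by (rule accepting_support_subset)
  have dE: "set d \<subseteq> E" if "d \<in> loops S q" for d using that SE by (auto simp: loops_def)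
  note rc = \<sigma>_closed[OF r]
  have dc: "\<sigma> (wlab d) \<in> carrier H" "glab d \<in> carrier K" if "d \<in> loops S q" for d
    using dE[OF that] by (simp_all add: \<sigma>_closed[OF wlab_closed] glab_closed)
  show thesis
  proof (rule subgroup_of_fractions[OF K.comm_group_axioms H.is_group, of "loop_labels S q r"])
    show "loop_labels S q r \<subseteq> carrier K \<times> carrier H"
      using dc rc by (auto simp: loop_labels_def)
    show "(\<one>\<^bsub>K\<^esub>, \<one>\<^bsub>H\<^esub>) \<in> loop_labels S q r"
      using Nil_in_loops rc
      by (auto simp: loop_labels_def glab_def wlab_def \<sigma>_Nil intro!: image_eqI[of _ _ "[]"])
  next
    fix g x g' x' assume "(g, x) \<in> loop_labels S q r" "(g', x') \<in> loop_labels S q r"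
    then obtain c d where cd: "c \<in> loops S q" "d \<in> loops S q" "g = glab c" "g' = glab d"
      "x = \<sigma> r \<otimes>\<^bsub>H\<^esub> \<sigma> (wlab c) \<otimes>\<^bsub>H\<^esub> inv\<^bsub>H\<^esub> \<sigma> r" "x' = \<sigma> r \<otimes>\<^bsub>H\<^esub> \<sigma> (wlab d) \<otimes>\<^bsub>H\<^esub> inv\<^bsub>H\<^esub> \<sigma> r"
      by (auto simp: loop_labels_def)
    have car: "\<sigma> (wlab c) \<in> carrier H" "\<sigma> (wlab d) \<in> carrier H" using cd dc by auto
    have "x \<otimes>\<^bsub>H\<^esub> x' = \<sigma> r \<otimes>\<^bsub>H\<^esub> \<sigma> (wlab c) \<otimes>\<^bsub>H\<^esub> (inv\<^bsub>H\<^esub> \<sigma> r \<otimes>\<^bsub>H\<^esub> \<sigma> r) \<otimes>\<^bsub>H\<^esub> \<sigma> (wlab d) \<otimes>\<^bsub>H\<^esub> inv\<^bsub>H\<^esub> \<sigma> r"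
      using car rc cd(5,6) by (simp only: H.m_assoc H.m_closed H.inv_closed)
    also have "\<dots> = \<sigma> r \<otimes>\<^bsub>H\<^esub> \<sigma> (wlab (c @ d)) \<otimes>\<^bsub>H\<^esub> inv\<^bsub>H\<^esub> \<sigma> r"
      using car rc cd dE wlab_closed by (simp add: \<sigma>_mult H.m_assoc)
    finally have "x \<otimes>\<^bsub>H\<^esub> x' = \<sigma> r \<otimes>\<^bsub>H\<^esub> \<sigma> (wlab (c @ d)) \<otimes>\<^bsub>H\<^esub> inv\<^bsub>H\<^esub> \<sigma> r" .
    moreover have "g \<otimes>\<^bsub>K\<^esub> g' = glab (c @ d)"
      using glab_append[OF dE[OF cd(1)] dE[OF cd(2)]] cd(3,4) by simp
    ultimately show "(g \<otimes>\<^bsub>K\<^esub> g', x \<otimes>\<^bsub>H\<^esub> x') \<in> loop_labels S q r"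
      unfolding loop_labels_def using loops_append[OF SE cd(1,2)]
      by (intro image_eqI[of _ _ "c @ d"]) simp_all
  next
    fix g x y assume "(g, x) \<in> loop_labels S q r" "(g, y) \<in> loop_labels S q r"
    then obtain c d where cd: "c \<in> loops S q" "d \<in> loops S q" "glab c = glab d"
      "x = \<sigma> r \<otimes>\<^bsub>H\<^esub> \<sigma> (wlab c) \<otimes>\<^bsub>H\<^esub> inv\<^bsub>H\<^esub> \<sigma> r" "y = \<sigma> r \<otimes>\<^bsub>H\<^esub> \<sigma> (wlab d) \<otimes>\<^bsub>H\<^esub> inv\<^bsub>H\<^esub> \<sigma> r"
      by (auto simp: loop_labels_def)
    then show "x = y" using loop_label_determined[OF S cd(1-3)] by simp
  qed (rule that)
qed

definition label_bound :: nat where "label_bound = (\<Sum>e\<in>E. length (wl e))"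

text \<open>
  Edges carry whole words, so a walk need not have a vertex at which exactly \<open>n\<close> letters have been
  read. It is cut where this number is first reached, and the excess is at most one edge label.
\<close>
definition reading_position :: "'e list \<Rightarrow> nat \<Rightarrow> nat" where
  "reading_position es n = (LEAST k. n \<le> length (wlab (take k es)))"

lemma reading_position_reached:
  assumes "n \<le> length (wlab es)"
  shows "n \<le> length (wlab (take (reading_position es n) es))"
    and "reading_position es n \<le> length es"
proof -
  have ex: "n \<le> length (wlab (take (length es) es))" using assms by simp
  show "n \<le> length (wlab (take (reading_position es n) es))"
    unfolding reading_position_def by (rule LeastI[of "\<lambda>k. n \<le> length (wlab (take k es))", OF ex])
  show "reading_position es n \<le> length es"
    unfolding reading_position_def by (rule Least_le[of "\<lambda>k. n \<le> length (wlab (take k es))", OF ex])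
qed

lemma reading_position_mono:
  assumes "m \<le> n" "n \<le> length (wlab es)"
  shows "reading_position es m \<le> reading_position es n"
  using reading_position_reached(1)[OF assms(2)] assms(1)
  unfolding reading_position_def[of es m] by (intro Least_le) simp

lemma reading_position_overshoot:
  assumes "n \<le> length (wlab es)" "set es \<subseteq> E"
  shows "length (wlab (take (reading_position es n) es)) \<le> n + label_bound"
proof (cases "reading_position es n")
  case 0
  then show ?thesis by (simp add: wlab_def)
next
  case (Suc k)
  then have k: "k < length es" using reading_position_reached(2)[OF assms(1)] by simp
  have "\<not> n \<le> length (wlab (take k es))"
    using not_less_Least[of k "\<lambda>k. n \<le> length (wlab (take k es))"] Suc
    by (simp add: reading_position_def)
  moreover have "length (wlab (take (Suc k) es)) = length (wlab (take k es)) + length (wl (es ! k))"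
    using k by (simp add: take_Suc_conv_app_nth) (simp add: wlab_def)
  moreover have "length (wl (es ! k)) \<le> label_bound"
    unfolding label_bound_def using k assms(2) finite_E by (intro member_le_sum) auto
  ultimately show ?thesis using Suc by simp
qed

definition remainders :: "'x list set" where
  "remainders = {r. set r \<subseteq> X \<and> length r \<le> label_bound}"

lemma finite_remainders: "finite remainders"
  unfolding remainders_def by (rule finite_lists_length_le[OF finite_X])

definition loop_indices :: "('e set \<times> 'q \<times> 'x list) set" where
  "loop_indices = {S. accepting_support S} \<times> insert p0 (tgt ` E) \<times> remainders"

lemma finite_loop_indices: "finite loop_indices"
proof -
  have "{S. accepting_support S} \<subseteq> Pow E" using accepting_support_subset by auto
  then have "finite {S. accepting_support S}" by (rule finite_subset) (simp add: finite_E)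
  then show ?thesis using finite_E finite_remainders by (simp add: loop_indices_def)
qed

section \<open>Quotients of prefixes\<close>

text \<open>
  An accepting walk for \<open>u n @ v n\<close> passes all the prefixes \<open>u 0, \<dots>, u n\<close>. The segment between two of
  them is an available closed walk once it can be taken out together with the edges of a smaller accepting
  walk with the same edge set: what then remains is the balanced list that cancels its register value.
\<close>
lemma loop_between_prefixes:
  fixes u :: "nat \<Rightarrow> 'x list"
  assumes chain: "\<And>i j. i \<le> j \<Longrightarrow> \<exists>w. u j = u i @ w" and u: "\<And>n. u n \<in> lists X"
  obtains i j S q r where "i < j" "(S, q, r) \<in> loop_indices"
    "inv\<^bsub>H\<^esub> \<sigma> (u i) \<otimes>\<^bsub>H\<^esub> \<sigma> (u j) \<in> snd ` loop_labels S q r"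
proof -
  have "\<exists>v t es. v \<in> lists X \<and> t \<in> T \<and> walk p0 es t \<and> glab es = \<one>\<^bsub>K\<^esub> \<and> wlab es = u n @ v" for n
  proof -
    obtain v where v: "v \<in> lists X" "\<sigma> v = inv\<^bsub>H\<^esub> \<sigma> (u n)"
      using \<sigma>_image \<sigma>_closed[OF u] H.inv_closed by (metis imageE)
    then have "\<sigma> (u n @ v) = \<one>\<^bsub>H\<^esub>" using u \<sigma>_closed by (simp add: \<sigma>_mult)
    moreover have "u n @ v \<in> lists X" using u v by simp
    ultimately show ?thesis using complete[of "u n @ v"] v(1) by metis
  qed
  then obtain v t \<omega> where v: "\<And>n. v n \<in> lists X" and t: "\<And>n. t n \<in> T"
    and \<omega>: "\<And>n. walk p0 (\<omega> n) (t n)" "\<And>n. glab (\<omega> n) = \<one>\<^bsub>K\<^esub>" "\<And>n. wlab (\<omega> n) = u n @ v n"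
    by metis
  have \<omega>E: "set (\<omega> n) \<subseteq> E" for n using walk_edges[OF \<omega>(1)] .
  define Q where "Q = insert p0 (tgt ` E)"
  have finQ: "finite Q" by (simp add: Q_def finite_E)
  have tQ: "t n \<in> Q" for n using walk_end[OF \<omega>(1)] by (simp add: Q_def)
  have "range (\<lambda>n. (set (\<omega> n), t n)) \<subseteq> Pow E \<times> Q" using \<omega>E tQ by auto
  then have fin_col: "finite (range (\<lambda>n. (set (\<omega> n), t n)))"
    by (rule finite_subset) (simp add: finite_E finQ)
  \<comment> \<open>The bound makes the \<open>n + 1\<close> prefixes outnumber the triples (state, overrun, number of
    reserved positions already passed).\<close>
  obtain m n where mn: "card (Q \<times> remainders \<times> {..length (\<omega> m)}) \<le> n"
    "(set (\<omega> m), t m) = (set (\<omega> n), t n)" "mset (\<omega> m) \<subseteq># mset (\<omega> n)"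
    using dickson_pair[OF finite_E _ fin_col, of "\<lambda>n. mset (\<omega> n)"
        "\<lambda>m. card (Q \<times> remainders \<times> {..length (\<omega> m)})"] \<omega>E by auto
  define S where "S = set (\<omega> n)"
  have S: "accepting_support S"
    unfolding accepting_support_def S_def using t[of n] \<omega>(1,2)[of n] by blast
  obtain P where P: "P \<subseteq> {..<length (\<omega> n)}" "card P = length (\<omega> m)"
    "image_mset ((!) (\<omega> n)) (mset_set P) = mset (\<omega> m)"
    using sub_mset_positions[OF mn(3)] by blast
  have finP: "finite P" using P(1) finite_subset by blast
  define pos where "pos j = reading_position (\<omega> n) (length (u j))" for j
  have len: "length (u j) \<le> length (wlab (\<omega> n))" if "j \<le> n" for j
    using chain[OF that] \<omega>(3)[of n] by auto
  have pos_le: "pos j \<le> length (\<omega> n)" if "j \<le> n" for j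
    using reading_position_reached(2)[OF len[OF that]] by (simp add: pos_def)
  have pos_mono: "pos i \<le> pos j" if "i \<le> j" "j \<le> n" for i j
    unfolding pos_def using chain[OF that(1)] len[OF that(2)] by (intro reading_position_mono) auto
  have ex_state: "\<exists>q. walk p0 (take (pos j) (\<omega> n)) q \<and> walk q (drop (pos j) (\<omega> n)) (t n)" for j
    using \<omega>(1)[of n] walk_append[of p0 "take (pos j) (\<omega> n)" "drop (pos j) (\<omega> n)"] by simp
  then obtain st where st: "\<And>j. walk p0 (take (pos j) (\<omega> n)) (st j)"
    by metis
  define re where "re j = drop (length (u j)) (wlab (take (pos j) (\<omega> n)))" for j
  have read: "wlab (take (pos j) (\<omega> n)) = u j @ re j" if j: "j \<le> n" for j
  proof -
    let ?x = "wlab (take (pos j) (\<omega> n))"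
    have "?x @ wlab (drop (pos j) (\<omega> n)) = u n @ v n"
      using \<omega>(3)[of n] wlab_append[of "take (pos j) (\<omega> n)" "drop (pos j) (\<omega> n)"] by simp
    then obtain w where w: "?x @ wlab (drop (pos j) (\<omega> n)) = u j @ w"
      using chain[OF j] by auto
    have "length (u j) \<le> length ?x"
      using reading_position_reached(1)[OF len[OF j]] by (simp add: pos_def)
    then have "take (length (u j)) ?x = u j" using arg_cong[OF w, of "take (length (u j))"] by simp
    then show ?thesis unfolding re_def by (metis append_take_drop_id)
  qed
  have takeX: "wlab (take k (\<omega> n)) \<in> lists X" for k
    using wlab_closed[of "take k (\<omega> n)"] \<omega>E[of n] set_take_subset[of k "\<omega> n"] by blast
  have re_mem: "re j \<in> remainders" if j: "j \<le> n" for j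
  proof -
    have "length (u j) + length (re j) \<le> length (u j) + label_bound"
      using reading_position_overshoot[OF len[OF j] \<omega>E] read[OF j] by (simp add: pos_def)
    moreover have "set (re j) \<subseteq> X" using takeX[of "pos j"] read[OF j] by auto
    ultimately show ?thesis by (simp add: remainders_def)
  qed
  define col where "col j = (st j, re j, card (P \<inter> {..<pos j}))" for j
  have "st j \<in> Q" for j using walk_end[OF st] by (simp add: Q_def)
  moreover have "card (P \<inter> {..<pos j}) \<le> length (\<omega> m)" for j
    using card_mono[OF finP, of "P \<inter> {..<pos j}"] P(2) by simp
  ultimately have "col ` {..n} \<subseteq> Q \<times> remainders \<times> {..length (\<omega> m)}"
    using re_mem by (auto simp: col_def)
  then have "card (col ` {..n}) \<le> n"
    using card_mono[of "Q \<times> remainders \<times> {..length (\<omega> m)}" "col ` {..n}"] mn(1) finQ finite_remainders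
    by simp
  then have "\<not> inj_on col {..n}" using card_image[of col "{..n}"] by auto
  then obtain i j where ij: "i < j" "j \<le> n" "col i = col j"
    unfolding inj_on_def by (metis atMost_iff linorder_neqE_nat)
  have same: "st i = st j" "re i = re j" "card (P \<inter> {..<pos i}) = card (P \<inter> {..<pos j})"
    using ij(3) by (simp_all add: col_def)
  have pij: "pos i \<le> pos j" "pos j \<le> length (\<omega> n)" using pos_mono[of i j] pos_le[of j] ij by simp_all
  define d where "d = drop (pos i) (take (pos j) (\<omega> n))"
  have take_j: "take (pos j) (\<omega> n) = take (pos i) (\<omega> n) @ d"
    using append_take_drop_id[of "pos i" "take (pos j) (\<omega> n)"] pij(1) by (simp add: d_def min_absorb1)
  have dE: "set d \<subseteq> S" unfolding d_def S_def by (meson order.trans set_drop_subset set_take_subset)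
  \<comment> \<open>Equal counts of reserved positions passed mean that the segment \<open>d\<close> contains none.\<close>
  have passed: "P \<inter> {..<pos i} = P \<inter> {..<pos j}"
    using same(3) pij(1) finP by (intro card_subset_eq) auto
  have disj: "P \<inter> {pos i..<pos j} = {}"
  proof (rule equals0I)
    fix x assume x: "x \<in> P \<inter> {pos i..<pos j}"
    then have "x \<in> P \<inter> {..<pos i}" unfolding passed by simp
    then show False using x by simp
  qed
  have "mset (\<omega> m) + mset d = image_mset ((!) (\<omega> n)) (mset_set (P \<union> {pos i..<pos j}))"
    unfolding d_def mset_slice[OF pij(2)] using P(3) disj finP by (simp add: mset_set_Union)
  also have "\<dots> \<subseteq># image_mset ((!) (\<omega> n)) (mset_set {0..<length (\<omega> n)})"
    using P(1) pij(2) by (intro image_mset_subseteq_mono subset_imp_msubset_mset_set) auto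
  also have "\<dots> = mset (\<omega> n)" using mset_slice[of "length (\<omega> n)" "\<omega> n" 0] by simp
  finally have sub: "mset (\<omega> m) + mset d \<subseteq># mset (\<omega> n)" .
  have wd: "walk (st i) d (st i)"
  proof -
    obtain q where "walk p0 (take (pos i) (\<omega> n)) q" "walk q d (st j)"
      using st[of j] by (auto simp: take_j walk_append)
    moreover have "walk p0 es q \<Longrightarrow> walk p0 es q' \<Longrightarrow> q = q'" for es q q' p0
      by (induction es arbitrary: p0) auto
    ultimately show ?thesis using st[of i] same(1) by metis
  qed
  obtain z where z: "mset (\<omega> n) = (mset (\<omega> m) + mset d) + mset z"
    using sub by (metis ex_mset subset_mset.add_diff_inverse)
  have "d \<in> loops S (st i)"
  proof -
    have "walk p0 (\<omega> m) (t n)" using \<omega>(1)[of m] mn(2) by simp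
    moreover have "mset (\<omega> n) - mset (\<omega> m) = mset d + mset z" using z by simp
    ultimately have "balanced (mset d + mset z)"
      using balanced_walk_diff[OF _ \<omega>(1)[of n] mn(3)] by simp
    then have bal: "balanced (mset z)"
      using balanced_diff[OF balanced_closed_walk[OF wd], of "mset d + mset z"] by simp
    have zS: "set z \<subseteq> S" using arg_cong[OF z, of set_mset] by (auto simp: S_def)
    have dz: "set (d @ z) \<subseteq> E" using dE zS accepting_support_subset[OF S] by auto
    have "glab (\<omega> n) = glab (\<omega> m @ (d @ z))" using z \<omega>E by (intro glab_cong_mset) simp_all
    then have "\<one>\<^bsub>K\<^esub> = glab (\<omega> m @ (d @ z))" using \<omega>(2) by simp
    also have "\<dots> = glab (d @ z)"
      using glab_append[OF \<omega>E dz] glab_closed[OF dz] \<omega>(2) by simp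
    finally show ?thesis using wd dE zS bal unfolding loops_def by auto
  qed
  moreover have "inv\<^bsub>H\<^esub> \<sigma> (u i) \<otimes>\<^bsub>H\<^esub> \<sigma> (u j) = \<sigma> (re i) \<otimes>\<^bsub>H\<^esub> \<sigma> (wlab d) \<otimes>\<^bsub>H\<^esub> inv\<^bsub>H\<^esub> \<sigma> (re i)"
  proof -
    have dX: "wlab d \<in> lists X" using dE accepting_support_subset[OF S] by (intro wlab_closed) auto
    have rX: "re i \<in> lists X" using re_mem[of i] ij by (auto simp: remainders_def)
    have "u j @ re i = (u i @ re i) @ wlab d"
      using read[of i] read[of j] ij same(2) take_j by simp
    then have "\<sigma> (u j) \<otimes>\<^bsub>H\<^esub> \<sigma> (re i) = \<sigma> (u i) \<otimes>\<^bsub>H\<^esub> \<sigma> (re i) \<otimes>\<^bsub>H\<^esub> \<sigma> (wlab d)"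
      using u[of i] u[of j] rX dX by (metis \<sigma>_mult append_in_lists_conv)
    then have "\<sigma> (u j) \<otimes>\<^bsub>H\<^esub> \<sigma> (re i) \<otimes>\<^bsub>H\<^esub> inv\<^bsub>H\<^esub> \<sigma> (re i)
        = \<sigma> (u i) \<otimes>\<^bsub>H\<^esub> \<sigma> (re i) \<otimes>\<^bsub>H\<^esub> \<sigma> (wlab d) \<otimes>\<^bsub>H\<^esub> inv\<^bsub>H\<^esub> \<sigma> (re i)"
      by simp
    then show ?thesis
      using \<sigma>_closed[OF u[of i]] \<sigma>_closed[OF u[of j]] \<sigma>_closed[OF rX] \<sigma>_closed[OF dX]
      by (simp add: H.m_assoc H.inv_solve_left')
  qed
  ultimately have "inv\<^bsub>H\<^esub> \<sigma> (u i) \<otimes>\<^bsub>H\<^esub> \<sigma> (u j) \<in> snd ` loop_labels S (st i) (re i)"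
    by (force simp: loop_labels_def)
  moreover have "(S, st i, re i) \<in> loop_indices"
    using S re_mem[of i] ij walk_end[OF st[of i]] by (simp add: loop_indices_def)
  ultimately show thesis using that[OF ij(1)] by blast
qed

text \<open>
  If none of the groups had finite index, then by Neumann's theorem finitely many of their cosets would
  never cover \<open>H\<close>. So any word could be prolonged until the inverse of its value avoids the right cosets
  determined by its prefixes, and iterating this yields a chain that contradicts
  \<open>loop_between_prefixes\<close>.
\<close>
lemma some_loop_group_has_finite_index:
  assumes A: "\<And>S q r. (S, q, r) \<in> loop_indices \<Longrightarrow>
      subgroup (A (S, q, r)) H \<and> snd ` loop_labels S q r \<subseteq> A (S, q, r)"
  shows "\<exists>i\<in>loop_indices. finite (rcosets\<^bsub>H\<^esub> (A i))"
proof (rule ccontr)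
  assume inf: "\<not> ?thesis"
  have Asub: "subgroup (A i) H" if "i \<in> loop_indices" for i
    using A that by (cases i) auto
  have step: "\<exists>w\<in>lists X. \<forall>k\<le>length x. \<forall>i\<in>loop_indices.
      inv\<^bsub>H\<^esub> \<sigma> (x @ w) \<otimes>\<^bsub>H\<^esub> \<sigma> (take k x) \<notin> A i" if x: "x \<in> lists X" for x
  proof -
    define F where "F = (\<lambda>k. inv\<^bsub>H\<^esub> \<sigma> (take k x)) ` {..length x}"
    have tX: "take k x \<in> lists X" for k using x by (auto dest: in_set_takeD)
    have F: "finite F" "F \<subseteq> carrier H" using \<sigma>_closed[OF tX] by (auto simp: F_def)
    have "\<not> carrier H \<subseteq> (\<Union>i\<in>loop_indices. A i <#>\<^bsub>H\<^esub> F)"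
      using H.neumann_cosets[of loop_indices A "\<lambda>_. F"] finite_loop_indices Asub F inf by blast
    then obtain h where h: "h \<in> carrier H" "\<And>i. i \<in> loop_indices \<Longrightarrow> h \<notin> A i <#>\<^bsub>H\<^esub> F" by auto
    obtain w where w: "w \<in> lists X" "\<sigma> w = inv\<^bsub>H\<^esub> \<sigma> x \<otimes>\<^bsub>H\<^esub> inv\<^bsub>H\<^esub> h"
      using \<sigma>_image \<sigma>_closed[OF x] h(1) by (metis H.inv_closed H.m_closed imageE)
    have xw: "inv\<^bsub>H\<^esub> \<sigma> (x @ w) = h"
      using x w h(1) \<sigma>_closed[OF x] by (simp add: \<sigma>_mult H.m_assoc[symmetric])
    have "h \<otimes>\<^bsub>H\<^esub> \<sigma> (take k x) \<notin> A i" if k: "k \<le> length x" and i: "i \<in> loop_indices" for k i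
    proof
      assume a: "h \<otimes>\<^bsub>H\<^esub> \<sigma> (take k x) \<in> A i"
      have "h = (h \<otimes>\<^bsub>H\<^esub> \<sigma> (take k x)) \<otimes>\<^bsub>H\<^esub> inv\<^bsub>H\<^esub> \<sigma> (take k x)"
        using h(1) \<sigma>_closed[OF tX] by (simp add: H.m_assoc)
      moreover have "inv\<^bsub>H\<^esub> \<sigma> (take k x) \<in> F" using k by (auto simp: F_def)
      ultimately have "h \<in> A i <#>\<^bsub>H\<^esub> F" using a unfolding set_mult_def by blast
      then show False using h(2) i by blast
    qed
    then show ?thesis using w(1) xw by (intro bexI[of _ w]) simp_all
  qed
  then have "\<forall>x\<in>lists X. \<exists>w. w \<in> lists X \<and> (\<forall>k\<le>length x. \<forall>i\<in>loop_indices.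
      inv\<^bsub>H\<^esub> \<sigma> (x @ w) \<otimes>\<^bsub>H\<^esub> \<sigma> (take k x) \<notin> A i)"
    by blast
  from bchoice[OF this] obtain nx where nx: "\<And>x. x \<in> lists X \<Longrightarrow> nx x \<in> lists X"
    "\<And>x k i. x \<in> lists X \<Longrightarrow> k \<le> length x \<Longrightarrow> i \<in> loop_indices \<Longrightarrow>
      inv\<^bsub>H\<^esub> \<sigma> (x @ nx x) \<otimes>\<^bsub>H\<^esub> \<sigma> (take k x) \<notin> A i"
    by blast
  define u where "u n = ((\<lambda>x. x @ nx x) ^^ n) []" for n
  have u_Suc: "u (Suc n) = u n @ nx (u n)" for n by (simp add: u_def)
  have u: "u n \<in> lists X" for n
  proof (induction n)
    case 0
    then show ?case by (simp add: u_def)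
  next
    case (Suc n)
    then show ?case using nx(1)[OF Suc] by (simp add: u_Suc)
  qed
  have chain: "\<exists>w. u j = u i @ w" if "i \<le> j" for i j
    using that
  proof (induction j rule: dec_induct)
    case (step j)
    then obtain w where "u j = u i @ w" by blast
    then have "u (Suc j) = u i @ (w @ nx (u j))" by (simp add: u_Suc)
    then show ?case by blast
  qed simp
  obtain i j S q r where *: "i < j" "(S, q, r) \<in> loop_indices"
    "inv\<^bsub>H\<^esub> \<sigma> (u i) \<otimes>\<^bsub>H\<^esub> \<sigma> (u j) \<in> snd ` loop_labels S q r"
    by (rule loop_between_prefixes[OF chain u])
  have mem: "inv\<^bsub>H\<^esub> \<sigma> (u i) \<otimes>\<^bsub>H\<^esub> \<sigma> (u j) \<in> A (S, q, r)" using * A by blast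
  have "inv\<^bsub>H\<^esub> (inv\<^bsub>H\<^esub> \<sigma> (u i) \<otimes>\<^bsub>H\<^esub> \<sigma> (u j)) \<in> A (S, q, r)"
    using mem Asub[OF *(2)] by (rule subgroup.m_inv_closed[rotated])
  then have in_A: "inv\<^bsub>H\<^esub> \<sigma> (u j) \<otimes>\<^bsub>H\<^esub> \<sigma> (u i) \<in> A (S, q, r)"
    using \<sigma>_closed[OF u] by (simp add: H.inv_mult_group)
  obtain j' where j': "j = Suc j'" "i \<le> j'" using *(1) by (cases j) auto
  obtain w where w: "u j' = u i @ w" using chain[OF j'(2)] by blast
  then have prefix: "take (length (u i)) (u j') = u i" "length (u i) \<le> length (u j')" by auto
  show False using nx(2)[OF u prefix(2) *(2)] in_A unfolding j'(1) u_Suc prefix(1) by (rule notE)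
qed

theorem finite_index_subgroup_embeds:
  "\<exists>L \<phi>. finite_index_subgroup L H \<and> \<phi> \<in> mon (H\<lparr>carrier := L\<rparr>) K"
proof -
  have "\<exists>R. subgroup R (K \<times>\<times> H) \<and> loop_labels S q r \<subseteq> R \<and>
      (\<forall>g x y. (g, x) \<in> R \<longrightarrow> (g, y) \<in> R \<longrightarrow> x = y)" if "(S, q, r) \<in> loop_indices" for S q r
  proof -
    have S: "accepting_support S" and r: "r \<in> lists X"
      using that by (auto simp: loop_indices_def remainders_def)
    show ?thesis by (rule loop_labels_subgroup[OF S r, of q]) blast
  qed
  then have "\<forall>i\<in>loop_indices. \<exists>R. subgroup R (K \<times>\<times> H)
      \<and> loop_labels (fst i) (fst (snd i)) (snd (snd i)) \<subseteq> R \<and>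
      (\<forall>g x y. (g, x) \<in> R \<longrightarrow> (g, y) \<in> R \<longrightarrow> x = y)" by auto
  then obtain R where R: "\<And>i. i \<in> loop_indices \<Longrightarrow> subgroup (R i) (K \<times>\<times> H)
      \<and> loop_labels (fst i) (fst (snd i)) (snd (snd i)) \<subseteq> R i \<and>
      (\<forall>g x y. (g, x) \<in> R i \<longrightarrow> (g, y) \<in> R i \<longrightarrow> x = y)" by metis
  interpret KH: group "K \<times>\<times> H" using K.is_group H.is_group by (rule DirProd_group)
  interpret snd: group_hom "K \<times>\<times> H" H snd
    by unfold_locales (auto simp: hom_def)
  have img: "subgroup (snd ` R i) H" if "i \<in> loop_indices" for i
    using R[OF that] by (intro snd.subgroup_img_is_subgroup) simp
  obtain i where i: "i \<in> loop_indices" "finite (rcosets\<^bsub>H\<^esub> (snd ` R i))"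
    using some_loop_group_has_finite_index[of "\<lambda>i. snd ` R i"] img R by (metis fst_conv image_mono snd_conv)
  have gen: "\<exists>ys. set ys \<subseteq> (\<lambda>x. \<sigma> [x]) ` X \<and> h = foldr (\<otimes>\<^bsub>H\<^esub>) ys \<one>\<^bsub>H\<^esub>" if h: "h \<in> carrier H" for h
  proof -
    obtain w where w: "w \<in> lists X" "h = \<sigma> w" using h \<sigma>_image by blast
    have "\<sigma> w = foldr (\<otimes>\<^bsub>H\<^esub>) (map (\<lambda>x. \<sigma> [x]) w) \<one>\<^bsub>H\<^esub>"
      using w(1)
    proof (induction w)
      case (Cons x w)
      then show ?case using \<sigma>_mult[of "[x]" w] by simp
    qed (simp add: \<sigma>_Nil)
    then show ?thesis using w by (intro exI[of _ "map (\<lambda>x. \<sigma> [x]) w"]) auto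
  qed
  show ?thesis
  proof (rule embedding_of_functional_relation[OF K.comm_group_axioms H.is_group])
    show "subgroup (R i) (K \<times>\<times> H)" using R[OF i(1)] by simp
    show "x = y" if "(g, x) \<in> R i" "(g, y) \<in> R i" for g x y using R[OF i(1)] that by blast
    show "finite ((\<lambda>x. \<sigma> [x]) ` X)" using finite_X by simp
    show "(\<lambda>x. \<sigma> [x]) ` X \<subseteq> carrier H" using \<sigma>_closed by auto
  qed (fact i(2), fact gen)
qed

end

section \<open>Automata over virtually abelian groups\<close>

lemma choice_of_generatorsD:
  assumes "choice_of_generators H X \<sigma>"
  shows "finite X" "\<sigma> ` lists X = carrier H"
    and "\<And>u v. u \<in> lists X \<Longrightarrow> v \<in> lists X \<Longrightarrow> \<sigma> (u @ v) = \<sigma> u \<otimes>\<^bsub>H\<^esub> \<sigma> v"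
  using assms by (auto simp: choice_of_generators_def epi_def hom_def free_monoid_def)

lemma path_label_iff_walk:
  assumes "finite_automaton_over (G \<times>\<times> free_monoid X) A" and "p \<in> states A"
  shows "path_label (G \<times>\<times> free_monoid X) A p (g, w) q \<longleftrightarrow>
    (\<exists>es. digraph.walk (edges A) fst (snd \<circ> snd) p es q
      \<and> foldr (\<otimes>\<^bsub>G\<^esub>) (map (fst \<circ> fst \<circ> snd) es) \<one>\<^bsub>G\<^esub> = g \<and> concat (map (snd \<circ> fst \<circ> snd) es) = w)"
    (is "?L \<longleftrightarrow> ?R")
proof
  show ?R if ?L
    using that
  proof (induction p "(g, w)" q arbitrary: g w rule: path_label.induct)
    case (empty_path p)
    then show ?case
      by (intro exI[of _ "[]"]) (simp add: digraph.walk.simps free_monoid_def one_DirProd)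
  next
    case (edge_path p m q n r)
    obtain a x b y where mn: "m = (a, x)" "n = (b, y)" by fastforce
    obtain es where "digraph.walk (edges A) fst (snd \<circ> snd) q es r"
      "foldr (\<otimes>\<^bsub>G\<^esub>) (map (fst \<circ> fst \<circ> snd) es) \<one>\<^bsub>G\<^esub> = b" "concat (map (snd \<circ> fst \<circ> snd) es) = y"
      using edge_path.hyps(3)[OF mn(2)] by blast
    then show ?case
      using edge_path.hyps(1,4) mn
      by (intro exI[of _ "(p, m, q) # es"]) (simp add: digraph.walk.simps free_monoid_def)
  qed
next
  assume ?R
  then obtain es where "digraph.walk (edges A) fst (snd \<circ> snd) p es q"
    "foldr (\<otimes>\<^bsub>G\<^esub>) (map (fst \<circ> fst \<circ> snd) es) \<one>\<^bsub>G\<^esub> = g" "concat (map (snd \<circ> fst \<circ> snd) es) = w"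
    by blast
  then show ?L
    using assms(2)
  proof (induction es arbitrary: p g w)
    case Nil
    then show ?case
      using path_label.empty_path[of p A "G \<times>\<times> free_monoid X"]
      by (simp add: digraph.walk.simps free_monoid_def one_DirProd)
  next
    case (Cons e es)
    obtain p' a x q' where e: "e = (p', (a, x), q')" by (metis prod.exhaust)
    have eA: "(p, (a, x), q') \<in> edges A" and q': "q' \<in> states A"
      and w: "digraph.walk (edges A) fst (snd \<circ> snd) q' es q"
      using Cons.prems(1) e assms(1)
      by (auto simp: digraph.walk.simps finite_automaton_over_def comp_def)
    show ?case
      using path_label.edge_path[OF eA Cons.IH[OF w refl refl q']] Cons.prems(2,3) e
      by (simp add: free_monoid_def)
  qed
qed

lemma accepted_language_iff_walk:
  assumes "M_automaton G X A" "w \<in> lists X"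
  shows "w \<in> accepted_language G X A \<longleftrightarrow>
    (\<exists>t\<in>terminals A. \<exists>es. digraph.walk (edges A) fst (snd \<circ> snd) (initial A) es t
      \<and> foldr (\<otimes>\<^bsub>G\<^esub>) (map (fst \<circ> fst \<circ> snd) es) \<one>\<^bsub>G\<^esub> = \<one>\<^bsub>G\<^esub> \<and> concat (map (snd \<circ> fst \<circ> snd) es) = w)"
proof -
  have "finite_automaton_over (G \<times>\<times> free_monoid X) A" "initial A \<in> states A"
    using assms(1) by (auto simp: M_automaton_def finite_automaton_over_def)
  from path_label_iff_walk[OF this] show ?thesis using assms(2) by (simp add: accepted_language_def)
qed

context coset_section
begin

text \<open>
  In the automaton with states \<open>(s, p)\<close>, the representative \<open>s\<close> of the register contents is kept in the state
  and only the cofactor in the register. \<open>walk_lift\<close> and \<open>walk_project\<close> say that its walks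
  are those of the original automaton.
\<close>
lemma walk_lift:
  assumes glE: "gl ` E \<subseteq> carrier G"
    and "digraph.walk E src tgt p es q" "x \<in> carrier G"
  shows "\<exists>fs. digraph.walk (rep ` carrier G \<times> E) (\<lambda>(s, e). (s, src e)) (\<lambda>(s, e). (rep (s \<otimes> gl e), tgt e))
      (rep x, p) fs (rep (rep x \<otimes> foldr (\<otimes>) (map gl es) \<one>), q)
    \<and> foldr (\<otimes>) (map (\<lambda>(s, e). cofactor (s \<otimes> gl e)) fs) \<one> = cofactor (rep x \<otimes> foldr (\<otimes>) (map gl es) \<one>)
    \<and> concat (map (\<lambda>(s, e). wl e) fs) = concat (map wl es)"
  using assms(2,3)
proof (induction es arbitrary: p x)
  case Nil
  then show ?case by (intro exI[of _ "[]"]) (simp add: digraph.walk.simps)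
next
  case (Cons e es)
  have e: "e \<in> E" "src e = p" and w: "digraph.walk E src tgt (tgt e) es q"
    using Cons.prems(1) by (simp_all add: digraph.walk.simps)
  have "set (map gl es) \<subseteq> carrier G" using digraph.walk_edges[OF w] glE by auto
  then have c: "gl e \<in> carrier G" "foldr (\<otimes>) (map gl es) \<one> \<in> carrier G"
    using glE e by (auto intro: multlist_closed)
  have xe: "rep x \<otimes> gl e \<in> carrier G" using Cons.prems(2) c by simp
  let ?s = "rep x" and ?m = "foldr (\<otimes>) (map gl es) \<one>"
  have assoc: "?s \<otimes> (gl e \<otimes> ?m) = (?s \<otimes> gl e) \<otimes> ?m" using Cons.prems(2) c by (simp add: m_assoc)
  obtain fs where fs: "digraph.walk (rep ` carrier G \<times> E) (\<lambda>(s, e). (s, src e)) (\<lambda>(s, e). (rep (s \<otimes> gl e), tgt e))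
      (rep (?s \<otimes> gl e), tgt e) fs (rep (rep (?s \<otimes> gl e) \<otimes> ?m), q)"
    "foldr (\<otimes>) (map (\<lambda>(s, e). cofactor (s \<otimes> gl e)) fs) \<one> = cofactor (rep (?s \<otimes> gl e) \<otimes> ?m)"
    "concat (map (\<lambda>(s, e). wl e) fs) = concat (map wl es)"
    using Cons.IH[OF w xe] by blast
  show ?case
    using fs e Cons.prems(2) cofactor_mult[OF xe c(2)] rep_rep_mult[OF xe c(2)]
    by (intro exI[of _ "(?s, e) # fs"]) (simp add: digraph.walk.simps assoc)
qed

lemma walk_project:
  assumes glE: "gl ` E \<subseteq> carrier G"
    and "digraph.walk (rep ` carrier G \<times> E) (\<lambda>(s, e). (s, src e)) (\<lambda>(s, e). (rep (s \<otimes> gl e), tgt e))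
      (rep x, p) fs (s', q)" "x \<in> carrier G"
  shows "\<exists>es. digraph.walk E src tgt p es q \<and> foldr (\<otimes>) (map gl es) \<one> \<in> carrier G
    \<and> s' = rep (rep x \<otimes> foldr (\<otimes>) (map gl es) \<one>)
    \<and> foldr (\<otimes>) (map (\<lambda>(s, e). cofactor (s \<otimes> gl e)) fs) \<one> = cofactor (rep x \<otimes> foldr (\<otimes>) (map gl es) \<one>)
    \<and> concat (map (\<lambda>(s, e). wl e) fs) = concat (map wl es)"
  using assms(2,3)
proof (induction fs arbitrary: p x)
  case Nil
  then show ?case by (intro exI[of _ "[]"]) (auto simp: digraph.walk.simps)
next
  case (Cons f fs)
  obtain s e where f: "f = (s, e)" by fastforce
  have e: "e \<in> E" "src e = p" "s = rep x"
    and w: "digraph.walk (rep ` carrier G \<times> E) (\<lambda>(s, e). (s, src e)) (\<lambda>(s, e). (rep (s \<otimes> gl e), tgt e))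
      (rep (rep x \<otimes> gl e), tgt e) fs (s', q)"
    using Cons.prems(1) f by (auto simp: digraph.walk.simps)
  have gl: "gl e \<in> carrier G" using glE e(1) by auto
  let ?s = "rep x"
  have xe: "?s \<otimes> gl e \<in> carrier G" using Cons.prems(2) gl by simp
  obtain es where es: "digraph.walk E src tgt (tgt e) es q" "foldr (\<otimes>) (map gl es) \<one> \<in> carrier G"
    "s' = rep (rep (?s \<otimes> gl e) \<otimes> foldr (\<otimes>) (map gl es) \<one>)"
    "foldr (\<otimes>) (map (\<lambda>(s, e). cofactor (s \<otimes> gl e)) fs) \<one>
      = cofactor (rep (?s \<otimes> gl e) \<otimes> foldr (\<otimes>) (map gl es) \<one>)"
    "concat (map (\<lambda>(s, e). wl e) fs) = concat (map wl es)"
    using Cons.IH[OF w xe] by blast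
  have assoc: "?s \<otimes> (gl e \<otimes> foldr (\<otimes>) (map gl es) \<one>) = (?s \<otimes> gl e) \<otimes> foldr (\<otimes>) (map gl es) \<one>"
    using Cons.prems(2) gl es(2) by (simp add: m_assoc)
  show ?case
    using es e f gl cofactor_mult[OF xe es(2)] rep_rep_mult[OF xe es(2)]
    by (intro exI[of _ "e # es"]) (simp add: digraph.walk.simps assoc)
qed

end

text \<open>
  A register value is \<open>\<one>\<close> exactly if its representative and its cofactor are, so adding the condition that the
  representative be \<open>\<one>\<close> to the terminal states preserves the accepted language. The new
  register group is an abelian subgroup of \<open>G\<close>.
\<close>
lemma embedding_if_accepted:
  fixes G :: "('g, 'b) monoid_scheme" and H :: "('h, 'd) monoid_scheme"
  assumes G: "group G" "virtually_abelian G" and H: "group H" and \<sigma>: "choice_of_generators H X \<sigma>"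
    and acc: "accepted_by_M_automaton G X (word_problem H X \<sigma>)"
  shows "\<exists>L \<phi>. finite_index_subgroup L H \<and> \<phi> \<in> mon (H\<lparr>carrier := L\<rparr>) G"
proof -
  interpret G: group G by fact
  obtain B where B: "finite_index_subgroup B G" "comm_group (G\<lparr>carrier := B\<rparr>)"
    using G(2) by (auto simp: virtually_abelian_def)
  obtain rep where "coset_section G B rep" using G.coset_section_exists[OF B(1)] .
  then interpret cs: coset_section G B rep .
  obtain A :: "(nat, 'g \<times> 'a list) automaton" where
    A: "M_automaton G X A" "accepted_language G X A = word_problem H X \<sigma>"
    using acc by (auto simp: accepted_by_M_automaton_def)
  define gl :: "nat \<times> ('g \<times> 'a list) \<times> nat \<Rightarrow> 'g" where "gl = fst \<circ> fst \<circ> snd"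
  define wl :: "nat \<times> ('g \<times> 'a list) \<times> nat \<Rightarrow> 'a list" where "wl = snd \<circ> fst \<circ> snd"
  have fin: "finite (edges A)" and gl: "\<And>e. e \<in> edges A \<Longrightarrow> gl e \<in> carrier G"
    and wl: "\<And>e. e \<in> edges A \<Longrightarrow> wl e \<in> lists X"
    using A(1)
    by (auto simp: M_automaton_def finite_automaton_over_def gl_def wl_def free_monoid_def)
  have glE: "gl ` edges A \<subseteq> carrier G" using gl by auto
  let ?walk = "digraph.walk (edges A) fst (snd \<circ> snd)"
  let ?E' = "rep ` carrier G \<times> edges A" and ?src' = "\<lambda>(s, e). (s, fst e)"
  let ?tgt' = "\<lambda>(s, e). (rep (s \<otimes>\<^bsub>G\<^esub> gl e), (snd \<circ> snd) e)"
  let ?gl' = "\<lambda>(s, e). cs.cofactor (s \<otimes>\<^bsub>G\<^esub> gl e)" and ?wl' = "\<lambda>(s :: 'g, e). wl e"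
  let ?one = "\<one>\<^bsub>G\<^esub>" and ?fold = "\<lambda>gs. foldr (\<otimes>\<^bsub>G\<^esub>) gs \<one>\<^bsub>G\<^esub>"
  have "abelian_automaton ?E' ?src' ?tgt' (G\<lparr>carrier := B\<rparr>) H ?gl' ?wl' X \<sigma>
      (?one, initial A) ({?one} \<times> terminals A)"
  proof (intro abelian_automaton.intro abelian_automaton_axioms.intro B(2) H)
    show "finite ?E'" using cs.finite_reps fin by simp
    show "finite X" "\<sigma> ` lists X = carrier H"
      and "\<And>u v. u \<in> lists X \<Longrightarrow> v \<in> lists X \<Longrightarrow> \<sigma> (u @ v) = \<sigma> u \<otimes>\<^bsub>H\<^esub> \<sigma> v"
      using choice_of_generatorsD[OF \<sigma>] by auto
    show "?gl' e \<in> carrier (G\<lparr>carrier := B\<rparr>)" if "e \<in> ?E'" for e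
      using that gl by (auto intro: cs.cofactor_in_B)
    show "?wl' e \<in> lists X" if e: "e \<in> ?E'" for e
    proof -
      obtain s d where "e = (s, d)" "d \<in> edges A" using e by blast
      then show ?thesis using wl[of d] by simp
    qed
  next
    fix w assume w: "w \<in> lists X"
    have "\<sigma> w = \<one>\<^bsub>H\<^esub> \<longleftrightarrow> w \<in> accepted_language G X A" using w A(2) by (simp add: word_problem_def)
    also have "\<dots> \<longleftrightarrow> (\<exists>t\<in>terminals A. \<exists>es. ?walk (initial A) es t
        \<and> ?fold (map gl es) = ?one \<and> concat (map wl es) = w)"
      unfolding gl_def wl_def by (rule accepted_language_iff_walk[OF A(1) w])
    also have "\<dots> \<longleftrightarrow> (\<exists>t\<in>{?one} \<times> terminals A. \<exists>fs.
        digraph.walk ?E' ?src' ?tgt' (?one, initial A) fs t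
        \<and> ?fold (map ?gl' fs) = ?one \<and> concat (map ?wl' fs) = w)" (is "?L \<longleftrightarrow> ?R")
    proof
      assume ?L
      then obtain t es where t: "t \<in> terminals A" "?walk (initial A) es t"
        "?fold (map gl es) = ?one" "concat (map wl es) = w" by blast
      show ?R
        using cs.walk_lift[OF glE t(2) G.one_closed, where wl = wl] t(1,3,4) cs.cofactor_one_rep[of ?one]
        by auto
    next
      assume ?R
      then obtain t fs where t: "t \<in> terminals A"
        and walk: "digraph.walk ?E' ?src' ?tgt' (rep ?one, initial A) fs (?one, t)"
        and one: "?fold (map ?gl' fs) = ?one" "concat (map ?wl' fs) = w" by auto
      obtain es where es: "?walk (initial A) es t" "?fold (map gl es) \<in> carrier G"
        "?one = rep (rep ?one \<otimes>\<^bsub>G\<^esub> ?fold (map gl es))"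
        "?fold (map ?gl' fs) = cs.cofactor (rep ?one \<otimes>\<^bsub>G\<^esub> ?fold (map gl es))"
        "concat (map ?wl' fs) = concat (map wl es)"
        using cs.walk_project[OF glE walk G.one_closed, where wl = wl] by blast
      have "?fold (map gl es) = ?one"
        using cs.cofactor_rep[OF es(2)] es(2-4) one(1) by simp
      then show ?L using t es(1,5) one(2) by auto
    qed
    finally show "\<sigma> w = \<one>\<^bsub>H\<^esub> \<longleftrightarrow> (\<exists>t\<in>{?one} \<times> terminals A. \<exists>fs.
        digraph.walk ?E' ?src' ?tgt' (?one, initial A) fs t
        \<and> foldr (\<otimes>\<^bsub>G\<lparr>carrier := B\<rparr>\<^esub>) (map ?gl' fs) \<one>\<^bsub>G\<lparr>carrier := B\<rparr>\<^esub> = \<one>\<^bsub>G\<lparr>carrier := B\<rparr>\<^esub>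
        \<and> concat (map ?wl' fs) = w)" by simp
  qed
  from abelian_automaton.finite_index_subgroup_embeds[OF this] obtain L \<phi>
    where L: "finite_index_subgroup L H" "\<phi> \<in> mon (H\<lparr>carrier := L\<rparr>) (G\<lparr>carrier := B\<rparr>)"
    by blast
  have "\<phi> \<in> mon (H\<lparr>carrier := L\<rparr>) G"
    using L(2) cs.B_carrier by (auto simp: mon_def hom_def)
  then show ?thesis using L(1) by blast
qed

text \<open>
  Reading \<open>w\<close> from the representative \<open>s\<close> leads to the representative of \<open>s \<cdot> \<sigma> w\<close> with the image under
  \<open>\<phi>\<close> of its cofactor in the register. Injectivity of \<open>\<phi>\<close> makes the register value \<open>\<one>\<close> mean that the cofactor is
  \<open>\<one>\<close>. Representatives are numbered because states are natural numbers.
\<close>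
lemma accepted_if_embedding:
  fixes G :: "('g, 'b) monoid_scheme" and H :: "('h, 'd) monoid_scheme"
  assumes "group G" "group H" and \<sigma>: "choice_of_generators H X \<sigma>"
    and L: "finite_index_subgroup L H" and \<phi>: "\<phi> \<in> mon (H\<lparr>carrier := L\<rparr>) G"
  shows "accepted_by_M_automaton G X (word_problem H X \<sigma>)"
proof -
  interpret G: group G by fact
  interpret H: group H by fact
  obtain rep where "coset_section H L rep" using H.coset_section_exists[OF L] .
  then interpret cs: coset_section H L rep .
  have homL: "\<phi> (a \<otimes>\<^bsub>H\<^esub> b) = \<phi> a \<otimes>\<^bsub>G\<^esub> \<phi> b" "\<phi> a \<in> carrier G" if "a \<in> L" "b \<in> L" for a b
    using \<phi> that by (auto simp: mon_def hom_def)
  have oneL: "\<one>\<^bsub>H\<^esub> \<in> L" using cs.subgroup_B subgroup.one_closed by blast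
  have \<phi>1: "\<phi> \<one>\<^bsub>H\<^esub> = \<one>\<^bsub>G\<^esub>"
    using homL[OF oneL oneL] G.r_cancel_one'[of "\<phi> \<one>\<^bsub>H\<^esub>" "\<phi> \<one>\<^bsub>H\<^esub>"] by auto
  have inj: "inj_on \<phi> L" using \<phi> by (simp add: mon_def)
  note gen = choice_of_generatorsD[OF \<sigma>]
  have \<sigma>c: "\<sigma> w \<in> carrier H" if "w \<in> lists X" for w using gen(2) that by blast
  have \<sigma>1: "\<sigma> [] = \<one>\<^bsub>H\<^esub>"
    using gen(3)[of "[]" "[]"] \<sigma>c[of "[]"] H.r_cancel_one'[of "\<sigma> []" "\<sigma> []"] by auto
  define R where "R = rep ` carrier H"
  have R: "s \<in> carrier H" "rep s = s" if "s \<in> R" for s using that by (auto simp: R_def)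
  have oneR: "\<one>\<^bsub>H\<^esub> \<in> R" using cs.rep_one by (metis R_def H.one_closed imageI)
  have repR: "rep x \<in> R" if "x \<in> carrier H" for x using that by (simp add: R_def)
  obtain num :: "'h \<Rightarrow> nat" where num: "inj_on num R"
    using finite_imp_inj_to_nat_seg[of R] cs.finite_reps R_def by blast
  define edge where
    "edge s x = (num s, (\<phi> (cs.cofactor (s \<otimes>\<^bsub>H\<^esub> \<sigma> [x])), [x]), num (rep (s \<otimes>\<^bsub>H\<^esub> \<sigma> [x])))" for s x
  define A where "A = \<lparr>states = num ` R, edges = (\<lambda>(s, x). edge s x) ` (R \<times> X),
    initial = num \<one>\<^bsub>H\<^esub>, terminals = {num \<one>\<^bsub>H\<^esub>}\<rparr>"
  let ?M = "G \<times>\<times> free_monoid X"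
  have M: "M_automaton G X A"
    unfolding M_automaton_def finite_automaton_over_def
    using gen(1) cs.finite_reps oneR R \<sigma>c homL(2)[OF cs.cofactor_in_B oneL]
    by (auto simp: A_def edge_def free_monoid_def R_def[symmetric] intro!: imageI repR)
  have step: "s \<otimes>\<^bsub>H\<^esub> \<sigma> (x # w) = (s \<otimes>\<^bsub>H\<^esub> \<sigma> [x]) \<otimes>\<^bsub>H\<^esub> \<sigma> w"
    "s \<otimes>\<^bsub>H\<^esub> \<sigma> [x] \<in> carrier H" "\<sigma> w \<in> carrier H"
    if "s \<in> R" "x \<in> X" "w \<in> lists X" for s x w
    using gen(3)[of "[x]" w] that R(1)[of s] \<sigma>c[of "[x]"] \<sigma>c[of w] by (auto simp: H.m_assoc)
  have cof_step: "\<phi> (cs.cofactor (s \<otimes>\<^bsub>H\<^esub> \<sigma> (x # w)))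
      = \<phi> (cs.cofactor (s \<otimes>\<^bsub>H\<^esub> \<sigma> [x])) \<otimes>\<^bsub>G\<^esub> \<phi> (cs.cofactor (rep (s \<otimes>\<^bsub>H\<^esub> \<sigma> [x]) \<otimes>\<^bsub>H\<^esub> \<sigma> w))"
    and rep_step: "rep (rep (s \<otimes>\<^bsub>H\<^esub> \<sigma> [x]) \<otimes>\<^bsub>H\<^esub> \<sigma> w) = rep (s \<otimes>\<^bsub>H\<^esub> \<sigma> (x # w))"
    if "s \<in> R" "x \<in> X" "w \<in> lists X" for s x w
    using step[OF that] cs.cofactor_mult[of "s \<otimes>\<^bsub>H\<^esub> \<sigma> [x]" "\<sigma> w"] cs.rep_rep_mult[of "s \<otimes>\<^bsub>H\<^esub> \<sigma> [x]" "\<sigma> w"]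
      homL(1)[OF cs.cofactor_in_B cs.cofactor_in_B] by auto
  have reads: "path_label ?M A (num s) (\<phi> (cs.cofactor (s \<otimes>\<^bsub>H\<^esub> \<sigma> w)), w) (num (rep (s \<otimes>\<^bsub>H\<^esub> \<sigma> w)))"
    if "w \<in> lists X" "s \<in> R" for w s
    using that
  proof (induction w arbitrary: s rule: list.induct)
    case Nil
    have "cs.cofactor s = \<one>\<^bsub>H\<^esub>" using R[OF Nil(2)] by (simp add: cs.cofactor_def)
    then show ?case
      using path_label.empty_path[of "num s" A ?M] Nil R[OF Nil(2)]
      by (simp add: A_def \<sigma>1 \<phi>1 free_monoid_def one_DirProd)
  next
    case (Cons x w)
    have x: "x \<in> X" "w \<in> lists X" using Cons.prems(1) by auto
    note st = step[OF Cons.prems(2) x]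
    have e: "(num s, (\<phi> (cs.cofactor (s \<otimes>\<^bsub>H\<^esub> \<sigma> [x])), [x]), num (rep (s \<otimes>\<^bsub>H\<^esub> \<sigma> [x]))) \<in> edges A"
      using Cons.prems(2) x by (auto simp: A_def edge_def)
    show ?case
      using path_label.edge_path[OF e Cons.IH[OF x(2) repR[OF st(2)]]]
        cof_step[OF Cons.prems(2) x] rep_step[OF Cons.prems(2) x]
      by (simp add: free_monoid_def)
  qed
  have only: "w \<in> lists X \<and> q = num (rep (s \<otimes>\<^bsub>H\<^esub> \<sigma> w)) \<and> g = \<phi> (cs.cofactor (s \<otimes>\<^bsub>H\<^esub> \<sigma> w))"
    if "path_label ?M A (num s) (g, w) q" "s \<in> R" for s g w q
    using that
  proof (induction "num s" "(g, w)" q arbitrary: s g w rule: path_label.induct)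
    case empty_path
    have "cs.cofactor s = \<one>\<^bsub>H\<^esub>" using R[OF empty_path.prems] by (simp add: cs.cofactor_def)
    then show ?case
      using empty_path R[OF empty_path.prems] by (simp add: \<sigma>1 \<phi>1 free_monoid_def one_DirProd)
  next
    case (edge_path m q n r)
    obtain s' x where s': "s' \<in> R" "x \<in> X" "(num s, m, q) = edge s' x"
      using edge_path.hyps(1) by (auto simp: A_def)
    then have "s' = s" using num edge_path.prems by (auto simp: edge_def inj_on_def)
    then have x: "x \<in> X" "m = (\<phi> (cs.cofactor (s \<otimes>\<^bsub>H\<^esub> \<sigma> [x])), [x])" "q = num (rep (s \<otimes>\<^bsub>H\<^esub> \<sigma> [x]))"
      using s' by (auto simp: edge_def)
    obtain h v where n: "n = (h, v)" by fastforce
    have sx: "s \<otimes>\<^bsub>H\<^esub> \<sigma> [x] \<in> carrier H" using R(1)[OF edge_path.prems] \<sigma>c[of "[x]"] x(1) by simp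
    have IH: "v \<in> lists X" "r = num (rep (rep (s \<otimes>\<^bsub>H\<^esub> \<sigma> [x]) \<otimes>\<^bsub>H\<^esub> \<sigma> v))"
      "h = \<phi> (cs.cofactor (rep (s \<otimes>\<^bsub>H\<^esub> \<sigma> [x]) \<otimes>\<^bsub>H\<^esub> \<sigma> v))"
      using edge_path.hyps(3)[OF x(3) n repR[OF sx]] by auto
    have "w = x # v" "g = \<phi> (cs.cofactor (s \<otimes>\<^bsub>H\<^esub> \<sigma> [x])) \<otimes>\<^bsub>G\<^esub> h"
      using edge_path.hyps(4) x(2) n by (auto simp: free_monoid_def)
    then show ?case
      using IH x(1) cof_step[OF edge_path.prems x(1) IH(1)] rep_step[OF edge_path.prems x(1) IH(1)]
      by simp
  qed
  have "accepted_language G X A = word_problem H X \<sigma>"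
  proof (intro equalityI subsetI)
    fix w assume "w \<in> accepted_language G X A"
    then have w: "w \<in> lists X" and p: "path_label ?M A (num \<one>\<^bsub>H\<^esub>) (\<one>\<^bsub>G\<^esub>, w) (num \<one>\<^bsub>H\<^esub>)"
      by (auto simp: accepted_language_def A_def)
    have c: "\<sigma> w \<in> carrier H" using \<sigma>c[OF w] .
    have "num \<one>\<^bsub>H\<^esub> = num (rep (\<sigma> w))" "\<phi> \<one>\<^bsub>H\<^esub> = \<phi> (cs.cofactor (\<sigma> w))"
      using only[OF p oneR] c \<phi>1 by simp_all
    then have "rep (\<sigma> w) = \<one>\<^bsub>H\<^esub>" "cs.cofactor (\<sigma> w) = \<one>\<^bsub>H\<^esub>"
      using inj_onD[OF num _ oneR repR[OF c]] inj_onD[OF inj _ oneL cs.cofactor_in_B[OF c]] by metis+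
    then have "\<sigma> w = \<one>\<^bsub>H\<^esub>" using cs.cofactor_rep[OF c] by simp
    then show "w \<in> word_problem H X \<sigma>" using w by (simp add: word_problem_def)
  next
    fix w assume "w \<in> word_problem H X \<sigma>"
    then have w: "w \<in> lists X" "\<sigma> w = \<one>\<^bsub>H\<^esub>" by (auto simp: word_problem_def)
    then show "w \<in> accepted_language G X A"
      using reads[OF w(1) oneR] cs.cofactor_B[OF oneL] \<phi>1
      by (auto simp: accepted_language_def A_def)
  qed
  then show ?thesis using M unfolding accepted_by_M_automaton_def by blast
qed

theorem theorem4:
  fixes G :: "('g, 'b) monoid_scheme"
    and H :: "('h, 'd) monoid_scheme"
    and X :: "'x set"
    and \<sigma> :: "'x list \<Rightarrow> 'h"
  assumes "group G"
    and "virtually_abelian G"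
    and "group H"
    and "choice_of_generators H X \<sigma>"
  shows "accepted_by_M_automaton G X (word_problem H X \<sigma>) \<longleftrightarrow>
    (\<exists>K \<phi>. finite_index_subgroup K H \<and> \<phi> \<in> mon (H\<lparr>carrier := K\<rparr>) G)"
  using embedding_if_accepted[OF assms] accepted_if_embedding[OF assms(1,3,4)] by blast

end
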